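(* Let $k$ be a field, $V$ a finite-dimensional $k$-vector space and $b:V\times V\to k$ an anisotropic symmetric $k$-bilinear form. Then the pure paraunitary group $\mathrm{PPU}(b)$ is a structure group for the orthomodular lattice $X(b)$, and $X(b)$ can be identified with the interval $[t^{-1},1]$ of $\mathrm{PPU}(b)$ in the right-invariant order with negative cone $\mathrm{PPU}(b)^-$, the orthocomplementation on this interval being $g\mapsto t^{-1}g^{-1}$. Explicitly: the interval $[t^{-1},1]=\{g\in \mathrm{PPU}(b): t^{-1}\le g\le 1\}$ with the induced order and the map $g\mapsto t^{-1}g^{-1}$ is an orthomodular lattice, and there is an isomorphism of orthomodular lattices $\iota: X(b)\to[t^{-1},1]$ such that $\iota$, viewed as a map into $\mathrm{PPU}(b)$, extends to a group isomorphism $G(X(b))\to \mathrm{PPU}(b)$.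
   Context: Anisotropic means $b(v,v)=0\Leftrightarrow v=0$. An orthomodular lattice (OML) is a bounded lattice $X$ with an order-reversing involution $x\mapsto x^*$ such that $x\wedge x^*=0$, $x\vee x^*=1$, and $x\le y\Rightarrow x\vee(x^*\wedge y)=y$. Isomorphisms of OMLs are lattice isomorphisms commuting with $*$. $X(b)$ is the OML of all $k$-subspaces of $V$ (meet is intersection, join is sum) with $U^*=\{v\in V: b(u,v)=0\ \forall u\in U\}$. For an OML $X$ write $x\top y$ if $y\ge x^*$. The structure group $G(X)$ is the group given by generators $X$ and relations $xy=z$ whenever $x\top y$ and $z=x\wedge y$ (the product $xy$ being taken in the group). Let $V[t,t^{-1}]:=k[t,t^{-1}]\otimes_k V$; its elements are finite sums $v=\sum_{i\in\mathbb Z}t^iv_i$ with $v_i\in V$. Define $\tilde b(v,w)=\sum_{n\in\mathbb Z} t^n\big(\sum_{i\in\mathbb Z} b(v_{i-n},w_i)\big)\in k[t,t^{-1}]$. Each $\varphi\in \mathrm{End}_{k[t,t^{-1}]}V[t,t^{-1}]$ is uniquely a finite sum $\varphi=\sum_i t^i\varphi_i$ with $\varphi_i\in\mathrm{End}_kV$; put $\varphi(1)=\sum_i\varphi_i$. The paraunitary group $\mathrm{PU}(b)$ is the group of all $k[t,t^{-1}]$-linear automorphisms $\varphi$ of $V[t,t^{-1}]$ with $\tilde b(\varphi(v),\varphi(w))=\tilde b(v,w)$ for all $v,w$. The pure paraunitary group is $\mathrm{PPU}(b)=\{\varphi\in \mathrm{PU}(b):\varphi(1)=\mathrm{id}_V\}$.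 The element $t^{-1}\in\mathrm{PPU}(b)$ denotes multiplication by $t^{-1}$, and $1$ denotes the identity. $\mathrm{PPU}(b)^-$ is the submonoid of those $\varphi\in\mathrm{PPU}(b)$ with $\varphi_i=0$ for all $i>0$. The right-invariant order with negative cone $\mathrm{PPU}(b)^-$ is $\varphi\le\psi:\Leftrightarrow\varphi\psi^{-1}\in \mathrm{PPU}(b)^-$. *)

theory Defs
  imports HOL.Vector_Spaces "HOL-Algebra.Group" "HOL-Library.Poly_Mapping"
begin

section \<open>Orthomodular lattices\<close>

record 'a ortho_order = "'a gorder" +
  ocomp :: "'a \<Rightarrow> 'a" (\<open>\<midarrow>\<index> _\<close> [81] 80)

locale orthomodular_lattice = bounded_lattice L for L (structure) +
  assumes ocomp_closed: "x \<in> carrier L \<Longrightarrow> \<midarrow> x \<in> carrier L"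
    and ocomp_involution: "x \<in> carrier L \<Longrightarrow> \<midarrow> (\<midarrow> x) = x"
    and ocomp_antimono:
      "\<lbrakk>x \<in> carrier L; y \<in> carrier L; x \<sqsubseteq> y\<rbrakk> \<Longrightarrow> \<midarrow> y \<sqsubseteq> \<midarrow> x"
    and meet_ocomp: "x \<in> carrier L \<Longrightarrow> x \<sqinter> \<midarrow> x = \<bottom>"
    and join_ocomp: "x \<in> carrier L \<Longrightarrow> x \<squnion> \<midarrow> x = \<top>"
    and orthomodular:
      "\<lbrakk>x \<in> carrier L; y \<in> carrier L; x \<sqsubseteq> y\<rbrakk> \<Longrightarrow> x \<squnion> (\<midarrow> x \<sqinter> y) = y"

definition oml_iso ::
    "('a, 'c) ortho_order_scheme \<Rightarrow> ('b, 'd) ortho_order_scheme \<Rightarrow> ('a \<Rightarrow> 'b) set"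
  where "oml_iso X Y = {f. bij_betw f (carrier X) (carrier Y) \<and>
    join_pres X Y f \<and> meet_pres X Y f \<and>
    (\<forall>x\<in>carrier X. f (\<midarrow>\<^bsub>X\<^esub> x) = \<midarrow>\<^bsub>Y\<^esub> (f x))}"


section \<open>Groups given by generators and relations\<close>

text \<open>
  A word over \<open>S\<close> is a list of letters \<open>(x, e)\<close> with \<open>x \<in> S\<close>; the letter \<open>(x, True)\<close>
  stands for \<open>x\<close>, the letter \<open>(x, False)\<close> for its formal inverse.
\<close>

type_synonym 'a word = "('a \<times> bool) list"

abbreviation words :: "'a set \<Rightarrow> 'a word set"
  where "words S \<equiv> lists (S \<times> UNIV)"

inductive pres_eq :: "'a set \<Rightarrow> ('a word \<times> 'a word) set \<Rightarrow> 'a word \<Rightarrow> 'a word \<Rightarrow> bool"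
  for S :: "'a set" and R :: "('a word \<times> 'a word) set"
  where
    pres_refl: "u \<in> words S \<Longrightarrow> pres_eq S R u u"
  | pres_sym: "pres_eq S R u v \<Longrightarrow> pres_eq S R v u"
  | pres_trans: "pres_eq S R u v \<Longrightarrow> pres_eq S R v w \<Longrightarrow> pres_eq S R u w"
  | pres_append: "pres_eq S R u u' \<Longrightarrow> pres_eq S R v v' \<Longrightarrow> pres_eq S R (u @ v) (u' @ v')"
  | pres_cancel: "x \<in> S \<Longrightarrow> pres_eq S R [(x, e), (x, \<not> e)] []"
  | pres_rel: "(u, v) \<in> R \<Longrightarrow> u \<in> words S \<Longrightarrow> v \<in> words S \<Longrightarrow> pres_eq S R u v"

definition pres_class :: "'a set \<Rightarrow> ('a word \<times> 'a word) set \<Rightarrow> 'a word \<Rightarrow> 'a word set"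
  where "pres_class S R u = {v. pres_eq S R u v}"

definition presented_group :: "'a set \<Rightarrow> ('a word \<times> 'a word) set \<Rightarrow> 'a word set monoid"
  where "presented_group S R =
    \<lparr>carrier = pres_class S R ` words S,
     mult = (\<lambda>A B. {w. \<exists>u\<in>A. \<exists>v\<in>B. pres_eq S R (u @ v) w}),
     one = pres_class S R []\<rparr>"

lemma pres_eq_words: "pres_eq S R u v \<Longrightarrow> u \<in> words S \<and> v \<in> words S"
  by (induction rule: pres_eq.induct) auto

lemma pres_class_eq_iff:
  assumes "u \<in> words S"
  shows "pres_class S R u = pres_class S R v \<longleftrightarrow> pres_eq S R u v"
proof
  assume "pres_class S R u = pres_class S R v"
  moreover have "u \<in> pres_class S R u"
    using assms by (simp add: pres_class_def pres_refl)
  ultimately show "pres_eq S R u v"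
    by (auto simp: pres_class_def intro: pres_sym)
qed (auto simp: pres_class_def intro: pres_trans pres_sym)

lemma presented_group_mult:
  assumes "u \<in> words S" "v \<in> words S"
  shows "pres_class S R u \<otimes>\<^bsub>presented_group S R\<^esub> pres_class S R v = pres_class S R (u @ v)"
proof -
  have "pres_eq S R (u @ v) w" if "pres_eq S R u u'" "pres_eq S R v v'" "pres_eq S R (u' @ v') w"
    for u' v' w
    using that by (meson pres_append pres_trans)
  moreover have "pres_eq S R u u" "pres_eq S R v v"
    using assms by (auto intro: pres_refl)
  ultimately show ?thesis
    by (auto simp: presented_group_def pres_class_def)
qed

abbreviation inv_word :: "'a word \<Rightarrow> 'a word"
  where "inv_word u \<equiv> rev (map (apsnd Not) u)"

lemma inv_word_words: "u \<in> words S \<Longrightarrow> inv_word u \<in> words S"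
  by (induction u rule: list.induct) auto

lemma pres_eq_inverse:
  assumes "u \<in> words S"
  shows "pres_eq S R (inv_word u @ u) []"
  using assms
proof (induction u rule: list.induct)
  case Nil
  then show ?case by (simp add: pres_refl)
next
  case (Cons a u)
  obtain x e where a: "a = (x, e)" by (cases a)
  have x: "x \<in> S" and u: "u \<in> words S" using Cons.prems a by simp_all
  have "pres_eq S R [(x, \<not> e), (x, e)] []"
    using pres_cancel[OF x, of R "\<not> e"] by simp
  then have "pres_eq S R ([(x, \<not> e), (x, e)] @ u) ([] @ u)"
    using u by (intro pres_append pres_refl)
  then have "pres_eq S R (inv_word u @ ([(x, \<not> e), (x, e)] @ u)) (inv_word u @ ([] @ u))"
    by (rule pres_append[OF pres_refl[OF inv_word_words[OF u]]])
  then have "pres_eq S R (inv_word (a # u) @ (a # u)) (inv_word u @ u)" using a by simp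
  then show ?case using Cons.IH[OF u] by (rule pres_trans)
qed

lemma group_presented_group: "group (presented_group S R)"
proof (rule groupI)
  let ?G = "presented_group S R"
  have carr: "carrier ?G = pres_class S R ` words S"
    and one: "\<one>\<^bsub>?G\<^esub> = pres_class S R []"
    by (simp_all add: presented_group_def)
  show "x \<otimes>\<^bsub>?G\<^esub> y \<in> carrier ?G" if xy: "x \<in> carrier ?G" "y \<in> carrier ?G" for x y
  proof -
    obtain u v where "u \<in> words S" "v \<in> words S" "x = pres_class S R u" "y = pres_class S R v"
      using xy unfolding carr by blast
    then have "x \<otimes>\<^bsub>?G\<^esub> y = pres_class S R (u @ v)" "u @ v \<in> words S"
      by (simp_all only: presented_group_mult append_in_lists_conv simp_thms)
    then show ?thesis unfolding carr by blast
  qed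
  show "\<one>\<^bsub>?G\<^esub> \<in> carrier ?G"
    unfolding carr one by (rule imageI) simp
  show "x \<otimes>\<^bsub>?G\<^esub> y \<otimes>\<^bsub>?G\<^esub> z = x \<otimes>\<^bsub>?G\<^esub> (y \<otimes>\<^bsub>?G\<^esub> z)"
    if xyz: "x \<in> carrier ?G" "y \<in> carrier ?G" "z \<in> carrier ?G" for x y z
  proof -
    obtain u v w where "u \<in> words S" "v \<in> words S" "w \<in> words S"
      "x = pres_class S R u" "y = pres_class S R v" "z = pres_class S R w"
      using xyz unfolding carr by blast
    then show ?thesis
      by (simp only: presented_group_mult append_in_lists_conv simp_thms append_assoc)
  qed
  show "\<one>\<^bsub>?G\<^esub> \<otimes>\<^bsub>?G\<^esub> x = x" if x: "x \<in> carrier ?G" for x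
  proof -
    obtain u where "u \<in> words S" "x = pres_class S R u"
      using x unfolding carr by blast
    then show ?thesis
      by (simp only: one presented_group_mult lists.Nil append_Nil)
  qed
  show "\<exists>y\<in>carrier ?G. y \<otimes>\<^bsub>?G\<^esub> x = \<one>\<^bsub>?G\<^esub>" if x: "x \<in> carrier ?G" for x
  proof -
    obtain u where u: "u \<in> words S" "x = pres_class S R u"
      using x unfolding carr by blast
    have v: "inv_word u \<in> words S" using u(1) by (rule inv_word_words)
    have "pres_class S R (inv_word u) \<otimes>\<^bsub>?G\<^esub> x = pres_class S R (inv_word u @ u)"
      unfolding u(2) using v u(1) by (rule presented_group_mult)
    also have "\<dots> = \<one>\<^bsub>?G\<^esub>"
      unfolding one
      by (rule pres_class_eq_iff[THEN iffD2, OF _ pres_eq_inverse[OF u(1)]])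
        (simp only: append_in_lists_conv u(1) v simp_thms)
    finally show ?thesis using v unfolding carr by blast
  qed
qed


section \<open>The structure group of an orthomodular lattice\<close>

definition structure_relations :: "('a, 'c) ortho_order_scheme \<Rightarrow> ('a word \<times> 'a word) set"
  where "structure_relations X =
    {([(x, True), (y, True)], [(x \<sqinter>\<^bsub>X\<^esub> y, True)]) | x y.
      x \<in> carrier X \<and> y \<in> carrier X \<and> \<midarrow>\<^bsub>X\<^esub> x \<sqsubseteq>\<^bsub>X\<^esub> y}"

definition structure_group :: "('a, 'c) ortho_order_scheme \<Rightarrow> 'a word set monoid"
  where "structure_group X = presented_group (carrier X) (structure_relations X)"

definition structure_gen :: "('a, 'c) ortho_order_scheme \<Rightarrow> 'a \<Rightarrow> 'a word set"
  where "structure_gen X x = pres_class (carrier X) (structure_relations X) [(x, True)]"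

lemma group_structure_group: "group (structure_group X)"
  unfolding structure_group_def by (rule group_presented_group)


section \<open>Anisotropic forms and the lattice of subspaces\<close>

locale anisotropic_form = finite_dimensional_vector_space scale Basis
  for scale :: "'k::field \<Rightarrow> 'v::ab_group_add \<Rightarrow> 'v" and Basis :: "'v set" +
  fixes b :: "'v \<Rightarrow> 'v \<Rightarrow> 'k"
  assumes linear_right: "Vector_Spaces.linear scale (*) (\<lambda>w. b v w)"
    and linear_left: "Vector_Spaces.linear scale (*) (\<lambda>v. b v w)"
    and symmetric: "b v w = b w v"
    and anisotropic: "b v v = 0 \<longleftrightarrow> v = 0"

definition subspace_lattice ::
    "('k::field \<Rightarrow> 'v::ab_group_add \<Rightarrow> 'v) \<Rightarrow> ('v \<Rightarrow> 'v \<Rightarrow> 'k) \<Rightarrow> 'v set ortho_order"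
  where "subspace_lattice scale b =
    \<lparr>carrier = {U. module.subspace scale U}, eq = (=), le = (\<subseteq>),
     ocomp = (\<lambda>U. {v. \<forall>u\<in>U. b u v = 0})\<rparr>"


lemma (in vector_space) subspace_lattice_meet:
  assumes "subspace U" "subspace W"
  shows "U \<sqinter>\<^bsub>subspace_lattice scale b\<^esub> W = U \<inter> W"
proof -
  let ?L = "subspace_lattice scale b"
  have Lower: "Lower ?L {U, W} = {X. subspace X \<and> X \<subseteq> U \<and> X \<subseteq> W}"
    using assms by (auto simp: Lower_def subspace_lattice_def)
  have greatestI: "greatest ?L X (Lower ?L {U, W}) \<longleftrightarrow> subspace X \<and> X \<subseteq> U \<and> X \<subseteq> W \<and>
      (\<forall>Y. subspace Y \<longrightarrow> Y \<subseteq> U \<longrightarrow> Y \<subseteq> W \<longrightarrow> Y \<subseteq> X)" for X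
    unfolding Lower greatest_def by (auto simp: subspace_lattice_def)
  have "greatest ?L (U \<inter> W) (Lower ?L {U, W})"
    unfolding greatestI using subspace_inter[OF assms] by blast
  moreover have "X = U \<inter> W" if "greatest ?L X (Lower ?L {U, W})" for X
    using that subspace_inter[OF assms] unfolding greatestI by blast
  ultimately have "(SOME X. greatest ?L X (Lower ?L {U, W})) = U \<inter> W"
    by (rule some_equality)
  then show ?thesis unfolding meet_def inf_def .
qed

lemma (in vector_space) subspace_lattice_join:
  assumes "subspace U" "subspace W"
  shows "U \<squnion>\<^bsub>subspace_lattice scale b\<^esub> W = {u + w | u w. u \<in> U \<and> w \<in> W}"
proof -
  let ?L = "subspace_lattice scale b" and ?S = "{u + w | u w. u \<in> U \<and> w \<in> W}"
  have S: "subspace ?S" using assms by (rule subspace_sums)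
  have US: "U \<subseteq> ?S"
  proof
    fix u assume "u \<in> U"
    then have "u = u + 0 \<and> u \<in> U \<and> 0 \<in> W" using subspace_0[OF assms(2)] by simp
    then show "u \<in> ?S" by blast
  qed
  have WS: "W \<subseteq> ?S"
  proof
    fix w assume "w \<in> W"
    then have "w = 0 + w \<and> 0 \<in> U \<and> w \<in> W" using subspace_0[OF assms(1)] by simp
    then show "w \<in> ?S" by blast
  qed
  have SX: "?S \<subseteq> X" if "subspace X" "U \<subseteq> X" "W \<subseteq> X" for X
  proof
    fix x assume "x \<in> ?S"
    then obtain u w where "x = u + w" "u \<in> U" "w \<in> W" by blast
    then show "x \<in> X" using that subspace_add[OF that(1)] by blast
  qed
  have Upper: "Upper ?L {U, W} = {X. subspace X \<and> U \<subseteq> X \<and> W \<subseteq> X}"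
    using assms by (auto simp: Upper_def subspace_lattice_def)
  have leastI: "least ?L X (Upper ?L {U, W}) \<longleftrightarrow> subspace X \<and> U \<subseteq> X \<and> W \<subseteq> X \<and>
      (\<forall>Y. subspace Y \<longrightarrow> U \<subseteq> Y \<longrightarrow> W \<subseteq> Y \<longrightarrow> X \<subseteq> Y)" for X
    unfolding Upper least_def by (auto simp: subspace_lattice_def)
  have least: "least ?L ?S (Upper ?L {U, W})"
    unfolding leastI using S US WS SX by blast
  have "X = ?S" if "least ?L X (Upper ?L {U, W})" for X
  proof (rule subset_antisym)
    have X: "subspace X" "U \<subseteq> X" "W \<subseteq> X"
      "\<And>Y. subspace Y \<Longrightarrow> U \<subseteq> Y \<Longrightarrow> W \<subseteq> Y \<Longrightarrow> X \<subseteq> Y"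
      using that unfolding leastI by blast+
    show "X \<subseteq> ?S" using S US WS by (rule X(4))
    show "?S \<subseteq> X" using X(1-3) by (rule SX)
  qed
  with least have "(SOME X. least ?L X (Upper ?L {U, W})) = ?S"
    by (rule some_equality)
  then show ?thesis unfolding join_def sup_def .
qed


section \<open>Laurent polynomials with coefficients in a vector space\<close>

text \<open>
  \<open>k[t, t\<^sup>-\<^sup>1]\<close> is the convolution ring \<open>int \<Rightarrow>\<^sub>0 'k\<close> and \<open>V[t, t\<^sup>-\<^sup>1]\<close> is \<open>int \<Rightarrow>\<^sub>0 'v\<close>;
  \<open>Poly_Mapping.single i x\<close> is \<open>t\<^sup>i x\<close> and \<open>Poly_Mapping.lookup v i\<close> is the coefficient \<open>v\<^sub>i\<close>.
\<close>

abbreviation monom :: "int \<Rightarrow> 'a::zero \<Rightarrow> int \<Rightarrow>\<^sub>0 'a"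
  where "monom \<equiv> Poly_Mapping.single"

definition laurent_scale ::
    "('k::field \<Rightarrow> 'v::ab_group_add \<Rightarrow> 'v) \<Rightarrow> (int \<Rightarrow>\<^sub>0 'k) \<Rightarrow> (int \<Rightarrow>\<^sub>0 'v) \<Rightarrow> (int \<Rightarrow>\<^sub>0 'v)"
  where "laurent_scale scale p v =
    (\<Sum>i\<in>Poly_Mapping.keys p. \<Sum>j\<in>Poly_Mapping.keys v. monom (i + j) (scale (Poly_Mapping.lookup p i) (Poly_Mapping.lookup v j)))"

definition laurent_form ::
    "('v::ab_group_add \<Rightarrow> 'v \<Rightarrow> 'k::field) \<Rightarrow> (int \<Rightarrow>\<^sub>0 'v) \<Rightarrow> (int \<Rightarrow>\<^sub>0 'v) \<Rightarrow> (int \<Rightarrow>\<^sub>0 'k)"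
  where "laurent_form b v w =
    Abs_poly_mapping (\<lambda>n. Sum_any (\<lambda>i. b (Poly_Mapping.lookup v (i - n)) (Poly_Mapping.lookup w i)))"

lemma laurent_form_finite:
  fixes b :: "'v::ab_group_add \<Rightarrow> 'v \<Rightarrow> 'k::field" and v w :: "int \<Rightarrow>\<^sub>0 'v"
  assumes "\<And>w. b 0 w = 0" "\<And>v. b v 0 = 0"
  shows "finite {n. Sum_any (\<lambda>i. b (Poly_Mapping.lookup v (i - n)) (Poly_Mapping.lookup w i)) \<noteq> 0}"
    and "finite {i. b (Poly_Mapping.lookup v (i - n)) (Poly_Mapping.lookup w i) \<noteq> 0}"
proof -
  let ?D = "(\<lambda>(i, j). i - j) ` (Poly_Mapping.keys w \<times> Poly_Mapping.keys v)"
  have "n \<in> ?D" if "b (Poly_Mapping.lookup v (i - n)) (Poly_Mapping.lookup w i) \<noteq> 0" for n i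
  proof -
    have "i \<in> Poly_Mapping.keys w" "i - n \<in> Poly_Mapping.keys v"
      using that assms by (metis in_keys_iff)+
    then show ?thesis by (intro image_eqI[of _ _ "(i, i - n)"]) simp_all
  qed
  then have "{n. Sum_any (\<lambda>i. b (Poly_Mapping.lookup v (i - n)) (Poly_Mapping.lookup w i)) \<noteq> 0} \<subseteq> ?D"
    by (auto elim!: Sum_any.not_neutral_obtains_not_neutral)
  then show "finite {n. Sum_any (\<lambda>i. b (Poly_Mapping.lookup v (i - n)) (Poly_Mapping.lookup w i)) \<noteq> 0}"
    by (rule finite_subset) simp
  have "{i. b (Poly_Mapping.lookup v (i - n)) (Poly_Mapping.lookup w i) \<noteq> 0} \<subseteq> Poly_Mapping.keys w"
    using assms by (auto simp: in_keys_iff)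
  then show "finite {i. b (Poly_Mapping.lookup v (i - n)) (Poly_Mapping.lookup w i) \<noteq> 0}"
    by (rule finite_subset) simp
qed

lemma lookup_laurent_form:
  fixes b :: "'v::ab_group_add \<Rightarrow> 'v \<Rightarrow> 'k::field"
  assumes "\<And>w. b 0 w = 0" "\<And>v. b v 0 = 0"
  shows "Poly_Mapping.lookup (laurent_form b v w) n =
    Sum_any (\<lambda>i. b (Poly_Mapping.lookup v (i - n)) (Poly_Mapping.lookup w i))"
  unfolding laurent_form_def using laurent_form_finite(1)[of b v w] assms by simp

context vector_space
begin

lemma laurent_scale_superset:
  assumes "finite A" "finite B" "Poly_Mapping.keys p \<subseteq> A" "Poly_Mapping.keys v \<subseteq> B"
  shows "laurent_scale scale p v =
    (\<Sum>i\<in>A. \<Sum>j\<in>B. monom (i + j) (Poly_Mapping.lookup p i *s Poly_Mapping.lookup v j))"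
proof -
  have "(\<Sum>j\<in>Poly_Mapping.keys v. monom (i + j) (Poly_Mapping.lookup p i *s Poly_Mapping.lookup v j)) =
      (\<Sum>j\<in>B. monom (i + j) (Poly_Mapping.lookup p i *s Poly_Mapping.lookup v j))" for i
    using assms by (intro sum.mono_neutral_left) (auto simp: in_keys_iff)
  then have "laurent_scale scale p v =
      (\<Sum>i\<in>Poly_Mapping.keys p. \<Sum>j\<in>B. monom (i + j) (Poly_Mapping.lookup p i *s Poly_Mapping.lookup v j))"
    by (simp add: laurent_scale_def)
  also have "\<dots> = (\<Sum>i\<in>A. \<Sum>j\<in>B. monom (i + j) (Poly_Mapping.lookup p i *s Poly_Mapping.lookup v j))"
    using assms by (intro sum.mono_neutral_left) (auto simp: in_keys_iff)
  finally show ?thesis .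
qed

lemma laurent_scale_monom:
  "laurent_scale scale (monom i a) (monom j v) = monom (i + j) (a *s v)"
  by (subst laurent_scale_superset[of "{i}" "{j}"]) auto

lemma laurent_scale_add_right:
  "laurent_scale scale p (v + w) = laurent_scale scale p v + laurent_scale scale p w"
proof -
  let ?A = "Poly_Mapping.keys p" and ?B = "Poly_Mapping.keys v \<union> Poly_Mapping.keys w"
  have "Poly_Mapping.keys (v + w) \<subseteq> ?B" by (rule Poly_Mapping.keys_add)
  then show ?thesis
    by (simp add: laurent_scale_superset[of ?A ?B] lookup_add scale_right_distrib
        single_add sum.distrib)
qed

lemma laurent_scale_add_left:
  "laurent_scale scale (p + q) v = laurent_scale scale p v + laurent_scale scale q v"
proof -
  let ?A = "Poly_Mapping.keys p \<union> Poly_Mapping.keys q" and ?B = "Poly_Mapping.keys v"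
  have "Poly_Mapping.keys (p + q) \<subseteq> ?A" by (rule Poly_Mapping.keys_add)
  then show ?thesis
    by (simp add: laurent_scale_superset[of ?A ?B] lookup_add scale_left_distrib
        single_add sum.distrib)
qed

lemma laurent_induct [case_names monom add]:
  fixes v :: "int \<Rightarrow>\<^sub>0 'c::comm_monoid_add"
  assumes "\<And>i x. P (monom i x)" "\<And>v w. P v \<Longrightarrow> P w \<Longrightarrow> P (v + w)"
  shows "P v"
proof (induction v rule: Poly_Mapping.update_induct)
  case const
  then show ?case using assms(1)[of 0 0] by simp
next
  case (update f i x)
  have "Poly_Mapping.update i x f = f + monom i x"
    using update(1) by (intro poly_mapping_eqI)
      (auto simp: lookup_add lookup_update lookup_single in_keys_iff)
  then show ?case using update assms by simp
qed

lemma module_laurent: "module (laurent_scale scale)"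
proof
  fix p q :: "int \<Rightarrow>\<^sub>0 'a" and v w :: "int \<Rightarrow>\<^sub>0 'b"
  show "laurent_scale scale p (v + w) = laurent_scale scale p v + laurent_scale scale p w"
    by (rule laurent_scale_add_right)
  show "laurent_scale scale (p + q) v = laurent_scale scale p v + laurent_scale scale q v"
    by (rule laurent_scale_add_left)
  show "laurent_scale scale p (laurent_scale scale q v) = laurent_scale scale (p * q) v"
  proof (induction v rule: laurent_induct)
    case (monom j x)
    show ?case
    proof (induction q rule: laurent_induct)
      case (monom k a)
      show ?case
        by (induction p rule: laurent_induct)
          (simp_all add: laurent_scale_monom laurent_scale_add_left distrib_right mult_single
            add.assoc)
    qed (simp add: laurent_scale_add_left laurent_scale_add_right distrib_left)
  qed (simp add: laurent_scale_add_right)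
  have "laurent_scale scale (monom 0 1) v = v"
    by (induction v rule: laurent_induct)
      (simp_all only: laurent_scale_add_right laurent_scale_monom add_0 scale_one)
  then show "laurent_scale scale 1 v = v" by simp
qed

end

text \<open>The components \<open>\<phi>\<^sub>i\<close> in \<open>\<phi> = \<Sum>\<^sub>i t\<^sup>i \<phi>\<^sub>i\<close>, and the value \<open>\<phi>(1) = \<Sum>\<^sub>i \<phi>\<^sub>i\<close>.\<close>

definition laurent_coeff ::
    "((int \<Rightarrow>\<^sub>0 'v) \<Rightarrow> (int \<Rightarrow>\<^sub>0 'v)) \<Rightarrow> int \<Rightarrow> 'v::ab_group_add \<Rightarrow> 'v"
  where "laurent_coeff \<phi> i v = Poly_Mapping.lookup (\<phi> (monom 0 v)) i"

definition eval_one :: "((int \<Rightarrow>\<^sub>0 'v) \<Rightarrow> (int \<Rightarrow>\<^sub>0 'v)) \<Rightarrow> 'v::ab_group_add \<Rightarrow> 'v"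
  where "eval_one \<phi> v = Sum_any (\<lambda>i. laurent_coeff \<phi> i v)"


section \<open>The pure paraunitary group\<close>

definition PU ::
    "('k::field \<Rightarrow> 'v::ab_group_add \<Rightarrow> 'v) \<Rightarrow> ('v \<Rightarrow> 'v \<Rightarrow> 'k) \<Rightarrow> ((int \<Rightarrow>\<^sub>0 'v) \<Rightarrow> (int \<Rightarrow>\<^sub>0 'v)) monoid"
  where "PU scale b =
    \<lparr>carrier = {\<phi>. module_hom (laurent_scale scale) (laurent_scale scale) \<phi> \<and> bij \<phi> \<and>
       (\<forall>v w. laurent_form b (\<phi> v) (\<phi> w) = laurent_form b v w)},
     mult = (\<circ>), one = id\<rparr>"

definition PPU ::
    "('k::field \<Rightarrow> 'v::ab_group_add \<Rightarrow> 'v) \<Rightarrow> ('v \<Rightarrow> 'v \<Rightarrow> 'k) \<Rightarrow> ((int \<Rightarrow>\<^sub>0 'v) \<Rightarrow> (int \<Rightarrow>\<^sub>0 'v)) monoid"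
  where "PPU scale b = (PU scale b)\<lparr>carrier := {\<phi> \<in> carrier (PU scale b). eval_one \<phi> = id}\<rparr>"

definition PPU_neg ::
    "('k::field \<Rightarrow> 'v::ab_group_add \<Rightarrow> 'v) \<Rightarrow> ('v \<Rightarrow> 'v \<Rightarrow> 'k) \<Rightarrow> ((int \<Rightarrow>\<^sub>0 'v) \<Rightarrow> (int \<Rightarrow>\<^sub>0 'v)) set"
  where "PPU_neg scale b = {\<phi> \<in> carrier (PPU scale b). \<forall>i>0. laurent_coeff \<phi> i = (\<lambda>v. 0)}"

definition PPU_order ::
    "('k::field \<Rightarrow> 'v::ab_group_add \<Rightarrow> 'v) \<Rightarrow> ('v \<Rightarrow> 'v \<Rightarrow> 'k) \<Rightarrow> ((int \<Rightarrow>\<^sub>0 'v) \<Rightarrow> (int \<Rightarrow>\<^sub>0 'v)) gorder"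
  where "PPU_order scale b =
    \<lparr>carrier = carrier (PPU scale b), eq = (=),
     le = (\<lambda>\<phi> \<psi>. \<phi> \<otimes>\<^bsub>PPU scale b\<^esub> inv\<^bsub>PPU scale b\<^esub> \<psi> \<in> PPU_neg scale b)\<rparr>"

definition t_inv ::
    "('k::field \<Rightarrow> 'v::ab_group_add \<Rightarrow> 'v) \<Rightarrow> (int \<Rightarrow>\<^sub>0 'v) \<Rightarrow> (int \<Rightarrow>\<^sub>0 'v)"
  where "t_inv scale = laurent_scale scale (monom (- 1) 1)"

definition PPU_interval ::
    "('k::field \<Rightarrow> 'v::ab_group_add \<Rightarrow> 'v) \<Rightarrow> ('v \<Rightarrow> 'v \<Rightarrow> 'k) \<Rightarrow> ((int \<Rightarrow>\<^sub>0 'v) \<Rightarrow> (int \<Rightarrow>\<^sub>0 'v)) ortho_order"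
  where "PPU_interval scale b =
    \<lparr>carrier = \<lbrace>t_inv scale..\<one>\<^bsub>PPU scale b\<^esub>\<rbrace>\<^bsub>PPU_order scale b\<^esub>,
     eq = (=), le = le (PPU_order scale b),
     ocomp = (\<lambda>g. t_inv scale \<otimes>\<^bsub>PPU scale b\<^esub> inv\<^bsub>PPU scale b\<^esub> g)\<rparr>"

section \<open>Basic facts\<close>

lemma PU_simps [simp]:
  "mult (PU scale b) = (\<circ>)" "one (PU scale b) = id"
  "mult (PPU scale b) = (\<circ>)" "one (PPU scale b) = id"
  by (simp_all add: PU_def PPU_def)

context vector_space
begin

abbreviation laurent_hom :: "((int \<Rightarrow>\<^sub>0 'b) \<Rightarrow> (int \<Rightarrow>\<^sub>0 'b)) \<Rightarrow> bool"
  where "laurent_hom \<equiv> module_hom (laurent_scale scale) (laurent_scale scale)"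

lemma laurent_hom_iff:
  "laurent_hom \<phi> \<longleftrightarrow> (\<forall>v w. \<phi> (v + w) = \<phi> v + \<phi> w) \<and>
     (\<forall>p v. \<phi> (laurent_scale scale p v) = laurent_scale scale p (\<phi> v))"
  using module_laurent by (auto simp: module_hom_def module_hom_axioms_def)

lemma lookup_laurent_shift:
  "Poly_Mapping.lookup (laurent_scale scale (monom i 1) v) n = Poly_Mapping.lookup v (n - i)"
proof (induction v rule: laurent_induct)
  case (monom j x)
  then show ?case by (auto simp: laurent_scale_monom lookup_single when_def)
qed (simp add: laurent_scale_add_right lookup_add)

lemma laurent_hom_monom:
  assumes "laurent_hom \<phi>"
  shows "Poly_Mapping.lookup (\<phi> (monom j x)) n = laurent_coeff \<phi> (n - j) x"
proof -
  have "monom j x = laurent_scale scale (monom j 1) (monom 0 x)"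
    by (simp add: laurent_scale_monom)
  then have "\<phi> (monom j x) = laurent_scale scale (monom j 1) (\<phi> (monom 0 x))"
    using assms by (metis laurent_hom_iff)
  then show ?thesis by (simp add: lookup_laurent_shift laurent_coeff_def)
qed

lemma laurent_coeff_add:
  assumes "laurent_hom \<phi>"
  shows "laurent_coeff \<phi> i (x + y) = laurent_coeff \<phi> i x + laurent_coeff \<phi> i y"
  using assms by (simp add: laurent_coeff_def single_add laurent_hom_iff lookup_add)

lemma laurent_coeff_scale:
  assumes "laurent_hom \<phi>"
  shows "laurent_coeff \<phi> i (a *s x) = a *s laurent_coeff \<phi> i x"
proof -
  have *: "Poly_Mapping.lookup (laurent_scale scale (monom 0 a) v) i = a *s Poly_Mapping.lookup v i"
    for v
  proof (induction v rule: laurent_induct)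
    case (monom j y)
    then show ?case by (simp add: laurent_scale_monom lookup_single when_def)
  qed (simp add: laurent_scale_add_right lookup_add scale_right_distrib)
  have "monom 0 (a *s x) = laurent_scale scale (monom 0 a) (monom 0 x)"
    by (simp add: laurent_scale_monom)
  then have "\<phi> (monom 0 (a *s x)) = laurent_scale scale (monom 0 a) (\<phi> (monom 0 x))"
    using assms by (metis laurent_hom_iff)
  then show ?thesis by (simp add: laurent_coeff_def *)
qed

lemma laurent_coeff_zero:
  assumes "laurent_hom \<phi>"
  shows "laurent_coeff \<phi> i 0 = 0"
  using laurent_coeff_add[OF assms, of i 0 0] by simp

lemma laurent_coeff_finite:
  assumes "laurent_hom \<phi>"
  shows "finite {i. laurent_coeff \<phi> i (Poly_Mapping.lookup w (n - i)) \<noteq> 0}"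
proof (rule finite_subset)
  show "{i. laurent_coeff \<phi> i (Poly_Mapping.lookup w (n - i)) \<noteq> 0}
      \<subseteq> (\<lambda>j. n - j) ` Poly_Mapping.keys w"
  proof
    fix i assume "i \<in> {i. laurent_coeff \<phi> i (Poly_Mapping.lookup w (n - i)) \<noteq> 0}"
    then have "n - i \<in> Poly_Mapping.keys w"
      using laurent_coeff_zero[OF assms] by (auto simp: in_keys_iff)
    then show "i \<in> (\<lambda>j. n - j) ` Poly_Mapping.keys w"
      by (intro image_eqI[of _ _ "n - i"]) simp_all
  qed
qed simp

lemma laurent_hom_expansion:
  assumes "laurent_hom \<phi>"
  shows "Poly_Mapping.lookup (\<phi> w) n =
    Sum_any (\<lambda>i. laurent_coeff \<phi> i (Poly_Mapping.lookup w (n - i)))"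
proof (induction w rule: laurent_induct)
  case (monom j x)
  have "laurent_coeff \<phi> i (x when j = n - i) = (laurent_coeff \<phi> i x when i = n - j)" for i
    using laurent_coeff_zero[OF assms] by (auto simp: when_def)
  then show ?case by (simp add: laurent_hom_monom[OF assms] lookup_single)
next
  case (add v w)
  then show ?case
    using assms
    by (simp add: laurent_hom_iff[of \<phi>] lookup_add laurent_coeff_add[OF assms]
        Sum_any.distrib laurent_coeff_finite[OF assms])
qed

lemma laurent_hom_eqI:
  assumes "laurent_hom \<phi>" "laurent_hom \<psi>" "\<And>i. laurent_coeff \<phi> i = laurent_coeff \<psi> i"
  shows "\<phi> = \<psi>"
  by (intro ext poly_mapping_eqI) (simp add: laurent_hom_expansion assms)

definition coeff_sum :: "(int \<Rightarrow>\<^sub>0 'b) \<Rightarrow> 'b"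
  where "coeff_sum v = Sum_any (Poly_Mapping.lookup v)"

lemma coeff_sum_add: "coeff_sum (v + w) = coeff_sum v + coeff_sum w"
  unfolding coeff_sum_def by (simp add: lookup_add Sum_any.distrib)

lemma coeff_sum_monom [simp]: "coeff_sum (monom i x) = x"
  unfolding coeff_sum_def by (simp add: lookup_single)

lemma eval_one_eq: "eval_one \<phi> x = coeff_sum (\<phi> (monom 0 x))"
  by (simp add: eval_one_def coeff_sum_def laurent_coeff_def)

lemma coeff_sum_hom:
  assumes "laurent_hom \<phi>"
  shows "coeff_sum (\<phi> w) = eval_one \<phi> (coeff_sum w)"
proof (induction w rule: laurent_induct)
  case (monom j x)
  have *: "coeff_sum (laurent_scale scale (monom j 1) v) = coeff_sum v" for v
    by (induction v rule: laurent_induct)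
      (simp_all add: laurent_scale_monom laurent_scale_add_right coeff_sum_add)
  have "monom j x = laurent_scale scale (monom j 1) (monom 0 x)"
    by (simp add: laurent_scale_monom)
  then have "\<phi> (monom j x) = laurent_scale scale (monom j 1) (\<phi> (monom 0 x))"
    using assms by (metis laurent_hom_iff)
  then show ?case by (simp add: * eval_one_eq)
next
  case (add v w)
  then show ?case
    using assms by (simp add: laurent_hom_iff[of \<phi>] coeff_sum_add eval_one_eq single_add)
qed

lemma eval_one_comp:
  assumes "laurent_hom \<phi>"
  shows "eval_one (\<phi> \<circ> \<psi>) = eval_one \<phi> \<circ> eval_one \<psi>"
  by (rule ext) (simp add: eval_one_eq[of "\<phi> \<circ> \<psi>"] eval_one_eq[of \<psi>] coeff_sum_hom[OF assms])

lemma eval_one_id: "eval_one id = (id :: 'b \<Rightarrow> 'b)"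
  by (rule ext) (simp add: eval_one_eq)

lemma group_PU: "group (PU scale b)"
proof (rule groupI)
  fix \<phi> \<psi> \<chi>
  show "\<phi> \<otimes>\<^bsub>PU scale b\<^esub> \<psi> \<in> carrier (PU scale b)"
    if "\<phi> \<in> carrier (PU scale b)" "\<psi> \<in> carrier (PU scale b)"
    using that by (auto simp: PU_def laurent_hom_iff intro: bij_comp)
  show "\<one>\<^bsub>PU scale b\<^esub> \<in> carrier (PU scale b)"
    by (auto simp: PU_def laurent_hom_iff)
  show "\<phi> \<otimes>\<^bsub>PU scale b\<^esub> \<psi> \<otimes>\<^bsub>PU scale b\<^esub> \<chi> = \<phi> \<otimes>\<^bsub>PU scale b\<^esub> (\<psi> \<otimes>\<^bsub>PU scale b\<^esub> \<chi>)"
    "\<one>\<^bsub>PU scale b\<^esub> \<otimes>\<^bsub>PU scale b\<^esub> \<phi> = \<phi>"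
    by (simp_all add: comp_assoc)
  show "\<exists>\<psi>\<in>carrier (PU scale b). \<psi> \<otimes>\<^bsub>PU scale b\<^esub> \<phi> = \<one>\<^bsub>PU scale b\<^esub>"
    if \<phi>: "\<phi> \<in> carrier (PU scale b)"
  proof
    have bij: "bij \<phi>" using \<phi> by (simp add: PU_def)
    then have inv: "\<phi> (inv_into UNIV \<phi> v) = v" "inv_into UNIV \<phi> (\<phi> v) = v" for v
      by (simp_all add: bij_is_surj surj_f_inv_f bij_is_inj)
    show "inv_into UNIV \<phi> \<in> carrier (PU scale b)"
    proof -
      have hom: "\<phi> (v + w) = \<phi> v + \<phi> w"
        "\<phi> (laurent_scale scale p v) = laurent_scale scale p (\<phi> v)" for p v w
        using \<phi> by (simp_all add: PU_def laurent_hom_iff)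
      have "laurent_hom (inv_into UNIV \<phi>)"
        unfolding laurent_hom_iff by (metis hom inv)
      moreover have "laurent_form b (inv_into UNIV \<phi> v) (inv_into UNIV \<phi> w) = laurent_form b v w"
        for v w
        using \<phi> inv by (simp add: PU_def) metis
      ultimately show ?thesis by (simp add: PU_def bij bij_imp_bij_inv)
    qed
    show "inv_into UNIV \<phi> \<otimes>\<^bsub>PU scale b\<^esub> \<phi> = \<one>\<^bsub>PU scale b\<^esub>"
      by (rule ext) (simp add: inv)
  qed
qed

lemma subgroup_PPU: "subgroup (carrier (PPU scale b)) (PU scale b)"
proof -
  interpret group "PU scale b" by (rule group_PU)
  show ?thesis
  proof (rule subgroupI)
    have hom: "laurent_hom \<phi>" if "\<phi> \<in> carrier (PU scale b)" for \<phi>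
      using that by (simp add: PU_def)
    show "carrier (PPU scale b) \<subseteq> carrier (PU scale b)"
      by (auto simp: PPU_def)
    show "carrier (PPU scale b) \<noteq> {}"
      using one_closed by (auto simp: PPU_def eval_one_id)
    show "\<phi> \<otimes>\<^bsub>PU scale b\<^esub> \<psi> \<in> carrier (PPU scale b)"
      if "\<phi> \<in> carrier (PPU scale b)" "\<psi> \<in> carrier (PPU scale b)" for \<phi> \<psi>
      using that m_closed[of \<phi> \<psi>] by (simp add: PPU_def hom eval_one_comp)
    show "inv\<^bsub>PU scale b\<^esub> \<phi> \<in> carrier (PPU scale b)" if \<phi>: "\<phi> \<in> carrier (PPU scale b)" for \<phi>
    proof -
      have \<phi>': "\<phi> \<in> carrier (PU scale b)" "eval_one \<phi> = id"
        using \<phi> by (simp_all add: PPU_def)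
      have "inv\<^bsub>PU scale b\<^esub> \<phi> \<circ> \<phi> = id"
        using l_inv[OF \<phi>'(1)] by simp
      then have "eval_one (inv\<^bsub>PU scale b\<^esub> \<phi>) \<circ> eval_one \<phi> = id"
        using \<phi>' by (metis eval_one_comp eval_one_id hom inv_closed)
      then show ?thesis using \<phi>' by (simp add: PPU_def)
    qed
  qed
qed

lemma group_PPU: "group (PPU scale b)"
proof -
  have "PPU scale b = (PU scale b)\<lparr>carrier := carrier (PPU scale b)\<rparr>"
    by (simp add: PPU_def)
  then show ?thesis
    using subgroup.subgroup_is_group[OF subgroup_PPU group_PU] by metis
qed

lemma PPU_hom: "\<phi> \<in> carrier (PPU scale b) \<Longrightarrow> laurent_hom \<phi>"
  by (simp add: PPU_def PU_def)

lemma PPU_neg_one: "id \<in> PPU_neg scale b"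
proof -
  interpret group "PPU scale b" by (rule group_PPU)
  show ?thesis
    using one_closed by (auto simp: PPU_neg_def laurent_coeff_def lookup_single)
qed

lemma PPU_neg_comp:
  assumes "\<phi> \<in> PPU_neg scale b" "\<psi> \<in> PPU_neg scale b"
  shows "\<phi> \<circ> \<psi> \<in> PPU_neg scale b"
proof -
  interpret group "PPU scale b" by (rule group_PPU)
  have mem: "\<phi> \<in> carrier (PPU scale b)" "\<psi> \<in> carrier (PPU scale b)"
    using assms by (simp_all add: PPU_neg_def)
  have "laurent_coeff (\<phi> \<circ> \<psi>) n x = 0" if "n > 0" for n x
  proof -
    have "laurent_coeff \<phi> i (laurent_coeff \<psi> (n - i) x) = 0" for i
    proof (cases "i > 0")
      case True
      then show ?thesis using assms(1) by (simp add: PPU_neg_def)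
    next
      case False
      then have "laurent_coeff \<psi> (n - i) x = 0" using assms(2) that by (simp add: PPU_neg_def)
      then show ?thesis by (simp add: laurent_coeff_zero PPU_hom[OF mem(1)])
    qed
    moreover have "laurent_coeff (\<phi> \<circ> \<psi>) n x =
        Sum_any (\<lambda>i. laurent_coeff \<phi> i (laurent_coeff \<psi> (n - i) x))"
      by (simp add: laurent_coeff_def[of "\<phi> \<circ> \<psi>"] laurent_coeff_def[of \<psi>]
          laurent_hom_expansion[OF PPU_hom[OF mem(1)]])
    ultimately show ?thesis by simp
  qed
  moreover have "\<phi> \<circ> \<psi> \<in> carrier (PPU scale b)"
    using m_closed[OF mem] by simp
  ultimately show ?thesis by (auto simp: PPU_neg_def)
qed

end

context anisotropic_form
begin

lemma form_zero [simp]: "b 0 w = 0" "b v 0 = 0"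
proof -
  interpret r: Vector_Spaces.linear scale "(*)" "\<lambda>w. b v w" by (rule linear_right)
  interpret l: Vector_Spaces.linear scale "(*)" "\<lambda>v. b v w" by (rule linear_left)
  show "b 0 w = 0" "b v 0 = 0" by (rule l.zero, rule r.zero)
qed

lemma laurent_coeff_finite_support:
  assumes "laurent_hom \<phi>"
  shows "finite {i. laurent_coeff \<phi> i \<noteq> (\<lambda>v. 0)}"
proof (rule finite_subset)
  show "{i. laurent_coeff \<phi> i \<noteq> (\<lambda>v. 0)} \<subseteq> (\<Union>x\<in>Basis. Poly_Mapping.keys (\<phi> (monom 0 x)))"
  proof (rule subsetI, rule ccontr)
    fix i assume i: "i \<in> {i. laurent_coeff \<phi> i \<noteq> (\<lambda>v. 0)}"
      and "i \<notin> (\<Union>x\<in>Basis. Poly_Mapping.keys (\<phi> (monom 0 x)))"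
    then have Basis: "laurent_coeff \<phi> i x = 0" if "x \<in> Basis" for x
      using that by (auto simp: laurent_coeff_def in_keys_iff)
    have "subspace {x. laurent_coeff \<phi> i x = 0}"
      by (rule subspaceI) (simp_all add: laurent_coeff_zero laurent_coeff_add laurent_coeff_scale assms)
    then have "span Basis \<subseteq> {x. laurent_coeff \<phi> i x = 0}"
      using Basis by (intro span_minimal) auto
    then show False using i span_Basis by auto
  qed
qed (use finite_Basis in simp)

lemma laurent_form_t_inv:
  "laurent_form b (t_inv scale v) (t_inv scale w) = laurent_form b v w"
proof (rule poly_mapping_eqI)
  fix n
  have "bij (\<lambda>i::int. i + 1)"
    by (rule o_bij[of "\<lambda>i. i - 1"]) auto
  then have "Sum_any (\<lambda>i. b (Poly_Mapping.lookup v (i - n)) (Poly_Mapping.lookup w i)) =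
      Sum_any (\<lambda>i. b (Poly_Mapping.lookup v (i - n + 1)) (Poly_Mapping.lookup w (i + 1)))"
    by (rule Sum_any.reindex_cong) (simp add: fun_eq_iff algebra_simps)
  then show "Poly_Mapping.lookup (laurent_form b (t_inv scale v) (t_inv scale w)) n =
      Poly_Mapping.lookup (laurent_form b v w) n"
    by (simp add: lookup_laurent_form t_inv_def lookup_laurent_shift)
qed

lemma t_inv_PPU: "t_inv scale \<in> carrier (PPU scale b)"
proof -
  interpret L: module "laurent_scale scale" by (rule module_laurent)
  have "t_inv scale \<circ> laurent_scale scale (monom 1 1) = id"
    "laurent_scale scale (monom 1 1) \<circ> t_inv scale = id"
    by (auto simp: t_inv_def mult_single)
  then have "bij (t_inv scale)" by (metis o_bij)
  moreover have "laurent_hom (t_inv scale)"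
    unfolding laurent_hom_iff by (simp add: t_inv_def L.scale_right_distrib mult.commute)
  moreover have "eval_one (t_inv scale) = id"
    by (rule ext) (simp add: eval_one_eq t_inv_def laurent_scale_monom)
  ultimately show ?thesis by (simp add: PPU_def PU_def laurent_form_t_inv)
qed

lemma PPU_neg_inverse:
  assumes "\<phi> \<in> PPU_neg scale b" "\<psi> \<in> PPU_neg scale b" "\<phi> \<circ> \<psi> = id"
  shows "\<phi> = id"
proof -
  have mem: "\<phi> \<in> carrier (PPU scale b)" "\<psi> \<in> carrier (PPU scale b)"
    using assms by (simp_all add: PPU_neg_def)
  then have hom: "laurent_hom \<phi>" "laurent_hom \<psi>" by (simp_all add: PPU_hom)
  have neg: "laurent_coeff \<phi> n x = 0" if "n < 0" for n x
  proof -
    have \<psi>: "laurent_coeff \<psi> (- n) y = 0" for y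
      using assms(2) that by (simp add: PPU_neg_def)
    have "Poly_Mapping.lookup (laurent_form b (monom 0 x) (\<psi> (monom 0 y))) (- n) = 0" for y
    proof -
      have "b (x when 0 = i - - n) (Poly_Mapping.lookup (\<psi> (monom 0 y)) i) = 0" for i
        using \<psi>[of y] by (cases "i = - n") (simp_all add: when_def laurent_coeff_def)
      then show ?thesis by (simp only: lookup_laurent_form form_zero lookup_single Sum_any.neutral)
    qed
    moreover have "laurent_form b (monom 0 x) (\<psi> (monom 0 y)) =
        laurent_form b (\<phi> (monom 0 x)) (monom 0 y)" for y
    proof -
      have "laurent_form b (\<phi> (monom 0 x)) (\<phi> (\<psi> (monom 0 y))) =
          laurent_form b (monom 0 x) (\<psi> (monom 0 y))"
        using mem(1) by (simp add: PPU_def PU_def)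
      then show ?thesis using assms(3) by (metis comp_apply id_apply)
    qed
    moreover have "Poly_Mapping.lookup (laurent_form b (\<phi> (monom 0 x)) (monom 0 y)) (- n) =
        b (laurent_coeff \<phi> n x) y" for y
    proof -
      have "b (Poly_Mapping.lookup (\<phi> (monom 0 x)) (i + n)) (y when 0 = i) =
          (b (laurent_coeff \<phi> n x) y when i = 0)" for i
        by (simp add: when_def laurent_coeff_def)
      then show ?thesis by (simp add: lookup_laurent_form lookup_single)
    qed
    ultimately have "b (laurent_coeff \<phi> n x) (laurent_coeff \<phi> n x) = 0" by metis
    then show ?thesis by (simp add: anisotropic)
  qed
  have "laurent_coeff \<phi> n x = 0" if "n \<noteq> 0" for n x
    using that neg assms(1) by (cases "n < 0") (simp_all add: PPU_neg_def)
  then have coeff: "laurent_coeff \<phi> n x = (laurent_coeff \<phi> 0 x when n = 0)" for n x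
    by (simp add: when_def)
  have "eval_one \<phi> x = laurent_coeff \<phi> 0 x" for x
    unfolding eval_one_def by (subst coeff) simp
  then have "laurent_coeff \<phi> n x = laurent_coeff id n x" for n x
    using mem(1) coeff[of n x] by (simp add: PPU_def laurent_coeff_def[of id] lookup_single when_def)
  then show ?thesis
    using hom(1) by (intro laurent_hom_eqI) (auto simp: laurent_hom_iff)
qed

lemma PPU_partial_order: "partial_order (PPU_order scale b)"
proof -
  interpret G: group "PPU scale b" by (rule group_PPU)
  let ?G = "PPU scale b"
  have le: "\<phi> \<sqsubseteq>\<^bsub>PPU_order scale b\<^esub> \<psi> \<longleftrightarrow> \<phi> \<otimes>\<^bsub>?G\<^esub> inv\<^bsub>?G\<^esub> \<psi> \<in> PPU_neg scale b" for \<phi> \<psi>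
    by (simp add: PPU_order_def)
  have refl: "\<phi> \<otimes>\<^bsub>?G\<^esub> inv\<^bsub>?G\<^esub> \<phi> \<in> PPU_neg scale b" if "\<phi> \<in> carrier ?G" for \<phi>
    using G.r_inv[OF that] PPU_neg_one by simp
  have antisym: "\<phi> = \<psi>" if mem: "\<phi> \<in> carrier ?G" "\<psi> \<in> carrier ?G"
    and "\<phi> \<otimes>\<^bsub>?G\<^esub> inv\<^bsub>?G\<^esub> \<psi> \<in> PPU_neg scale b" "\<psi> \<otimes>\<^bsub>?G\<^esub> inv\<^bsub>?G\<^esub> \<phi> \<in> PPU_neg scale b" for \<phi> \<psi>
  proof -
    have "(\<phi> \<otimes>\<^bsub>?G\<^esub> inv\<^bsub>?G\<^esub> \<psi>) \<otimes>\<^bsub>?G\<^esub> (\<psi> \<otimes>\<^bsub>?G\<^esub> inv\<^bsub>?G\<^esub> \<phi>) = \<one>\<^bsub>?G\<^esub>"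
      using mem by (metis G.inv_closed G.inv_mult_group G.inv_inv G.m_closed G.r_inv)
    then have "\<phi> \<otimes>\<^bsub>?G\<^esub> inv\<^bsub>?G\<^esub> \<psi> = \<one>\<^bsub>?G\<^esub>"
      using PPU_neg_inverse[OF that(3,4)] by simp
    then show ?thesis using mem by (metis G.inv_closed G.inv_equality G.inv_inv)
  qed
  have trans: "\<phi> \<otimes>\<^bsub>?G\<^esub> inv\<^bsub>?G\<^esub> \<chi> \<in> PPU_neg scale b"
    if mem: "\<phi> \<in> carrier ?G" "\<psi> \<in> carrier ?G" "\<chi> \<in> carrier ?G"
    and "\<phi> \<otimes>\<^bsub>?G\<^esub> inv\<^bsub>?G\<^esub> \<psi> \<in> PPU_neg scale b" "\<psi> \<otimes>\<^bsub>?G\<^esub> inv\<^bsub>?G\<^esub> \<chi> \<in> PPU_neg scale b" for \<phi> \<psi> \<chi>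
  proof -
    have "(\<phi> \<otimes>\<^bsub>?G\<^esub> inv\<^bsub>?G\<^esub> \<psi>) \<otimes>\<^bsub>?G\<^esub> (\<psi> \<otimes>\<^bsub>?G\<^esub> inv\<^bsub>?G\<^esub> \<chi>) = \<phi> \<otimes>\<^bsub>?G\<^esub> inv\<^bsub>?G\<^esub> \<chi>"
      using mem by (metis G.inv_closed G.m_assoc G.m_closed G.l_inv G.l_one)
    then show ?thesis using PPU_neg_comp[OF that(4,5)] by simp
  qed
  have carr: "carrier (PPU_order scale b) = carrier ?G"
    and eq: "(.=\<^bsub>PPU_order scale b\<^esub>) = (=)"
    by (simp_all add: PPU_order_def)
  show ?thesis
    by unfold_locales (unfold carr eq le, (blast intro: refl antisym trans)+)
qed

lemma PPU_order_right_invariant: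
  assumes "\<phi> \<in> carrier (PPU scale b)" "\<psi> \<in> carrier (PPU scale b)" "\<chi> \<in> carrier (PPU scale b)"
    and "\<phi> \<sqsubseteq>\<^bsub>PPU_order scale b\<^esub> \<psi>"
  shows "\<phi> \<otimes>\<^bsub>PPU scale b\<^esub> \<chi> \<sqsubseteq>\<^bsub>PPU_order scale b\<^esub> \<psi> \<otimes>\<^bsub>PPU scale b\<^esub> \<chi>"
proof -
  interpret G: group "PPU scale b" by (rule group_PPU)
  let ?G = "PPU scale b"
  have "(\<phi> \<otimes>\<^bsub>?G\<^esub> \<chi>) \<otimes>\<^bsub>?G\<^esub> inv\<^bsub>?G\<^esub> (\<psi> \<otimes>\<^bsub>?G\<^esub> \<chi>) = \<phi> \<otimes>\<^bsub>?G\<^esub> inv\<^bsub>?G\<^esub> \<psi>"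
    using assms(1-3)
    by (metis G.inv_closed G.inv_mult_group G.inv_solve_right G.m_assoc G.m_closed)
  then show ?thesis using assms(4) by (simp add: PPU_order_def)
qed

end

end

(*
Let P_U and Q_U be the orthogonal projections to a subspace U and to its complement; anisotropy makes
them exist. The isomorphism sends U to e(U) = P_U + t^-1 Q_U, and e(U) e(W) = e(U \<inter> W) if W contains
the complement of U.

Suppose that phi is paraunitary, phi(1) = 1 and phi = phi_0 + t^-1 phi_(-1) + ... + t^-m phi_(-m) with m > 0.
Comparing coefficients in b(phi x, phi y) = b(x, y) shows that the images of phi_0 and phi_(-m) are
orthogonal, so that phi = e(im phi_0) psi where psi has length m - 1. For m = 1 this identifies the
interval, and by induction every phi is a product of elements e(U) and powers of the central element t.

For injectivity, up to powers of the central generator 0, which goes to t^-1, each element of the structure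
group is a product p of generators. The Sasaki identity x y = (x \<sqinter> (x* \<squnion> y)) w in the structure group
shows that p = (im phi_0) q with q again a product of generators, where phi is the image of p. So the
factorization of phi is lifted to p, and p is determined by phi.
*)

theory Submission
  imports Defs "HOL-Algebra.Coset"
begin

section \<open>Homomorphisms out of presented groups\<close>

definition eval_word :: "('b, 'm) monoid_scheme \<Rightarrow> ('a \<Rightarrow> 'b) \<Rightarrow> 'a word \<Rightarrow> 'b"
  where "eval_word G f u =
    foldr (\<lambda>(x, e) g. (if e then f x else inv\<^bsub>G\<^esub> f x) \<otimes>\<^bsub>G\<^esub> g) u \<one>\<^bsub>G\<^esub>"

lemma eval_word_simps [simp]:
  "eval_word G f [] = \<one>\<^bsub>G\<^esub>"
  "eval_word G f ((x, e) # u) = (if e then f x else inv\<^bsub>G\<^esub> f x) \<otimes>\<^bsub>G\<^esub> eval_word G f u"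
  by (simp_all add: eval_word_def)

context group
begin

lemma eval_word_closed [simp]:
  "f \<in> S \<rightarrow> carrier G \<Longrightarrow> u \<in> words S \<Longrightarrow> eval_word G f u \<in> carrier G"
  by (induction u rule: list.induct) (auto simp: Pi_iff)

lemma eval_word_append:
  assumes "f \<in> S \<rightarrow> carrier G" "u \<in> words S" "v \<in> words S"
  shows "eval_word G f (u @ v) = eval_word G f u \<otimes> eval_word G f v"
  using assms(2)
proof (induction u rule: list.induct)
  case (Cons a u)
  then show ?case using assms(1,3) by (cases a) (auto simp: m_assoc Pi_iff)
qed (use assms in simp)

lemma eval_word_pres_eq:
  assumes f: "f \<in> S \<rightarrow> carrier G"
    and R: "\<And>u v. (u, v) \<in> R \<Longrightarrow> u \<in> words S \<Longrightarrow> v \<in> words S \<Longrightarrow> eval_word G f u = eval_word G f v"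
    and "pres_eq S R u v"
  shows "eval_word G f u = eval_word G f v"
  using assms(3)
proof induction
  case (pres_append u u' v v')
  then show ?case
    using pres_eq_words[OF pres_append.hyps(1)] pres_eq_words[OF pres_append.hyps(2)]
    by (simp add: eval_word_append[OF f])
next
  case (pres_cancel x e)
  then show ?case using f by (auto simp: Pi_iff)
qed (use R in auto)

text \<open>Von Dyck's theorem for these presentations. By \<open>eval_word_pres_eq\<close> the
  value of a word depends only on its class: steps by a relation are covered by \<open>R\<close>,
  and all other steps hold in every group.\<close>

lemma presented_group_hom_ext:
  assumes f: "f \<in> S \<rightarrow> carrier G"
    and R: "\<And>u v. (u, v) \<in> R \<Longrightarrow> u \<in> words S \<Longrightarrow> v \<in> words S \<Longrightarrow> eval_word G f u = eval_word G f v"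
  obtains \<Phi> where "\<Phi> \<in> hom (presented_group S R) G"
    "\<And>u. u \<in> words S \<Longrightarrow> \<Phi> (pres_class S R u) = eval_word G f u"
proof
  \<comment> \<open>An element of the presented group is a set of words, so the map evaluates an
    arbitrarily chosen member of it.\<close>
  let ?\<Phi> = "\<lambda>A. eval_word G f (SOME u. u \<in> A)"
  show \<Phi>: "?\<Phi> (pres_class S R u) = eval_word G f u" if "u \<in> words S" for u
  proof -
    have "u \<in> pres_class S R u" using that by (simp add: pres_class_def pres_refl)
    then have "(SOME v. v \<in> pres_class S R u) \<in> pres_class S R u" by (rule someI)
    then show ?thesis using eval_word_pres_eq[OF f R] by (simp add: pres_class_def)
  qed
  have carr: "carrier (presented_group S R) = pres_class S R ` words S"
    by (simp add: presented_group_def)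
  have mult: "?\<Phi> (pres_class S R u \<otimes>\<^bsub>presented_group S R\<^esub> pres_class S R v) =
      ?\<Phi> (pres_class S R u) \<otimes> ?\<Phi> (pres_class S R v)" if "u \<in> words S" "v \<in> words S" for u v
  proof -
    have "u @ v \<in> words S" using that by simp
    then show ?thesis
      unfolding presented_group_mult[OF that] \<Phi>[OF that(1)] \<Phi>[OF that(2)]
      by (simp only: \<Phi> eval_word_append[OF f that])
  qed
  show "?\<Phi> \<in> hom (presented_group S R) G"
  proof (rule homI)
    fix A assume "A \<in> carrier (presented_group S R)"
    then obtain u where u: "A = pres_class S R u" "u \<in> words S" unfolding carr by (rule imageE)
    show "?\<Phi> A \<in> carrier G"
      unfolding u(1) \<Phi>[OF u(2)] using f u(2) by (rule eval_word_closed)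
    fix B assume "B \<in> carrier (presented_group S R)"
    then obtain v where v: "B = pres_class S R v" "v \<in> words S" unfolding carr by (rule imageE)
    show "?\<Phi> (A \<otimes>\<^bsub>presented_group S R\<^esub> B) = ?\<Phi> A \<otimes> ?\<Phi> B"
      unfolding u(1) v(1) using u(2) v(2) by (rule mult)
  qed
qed

end


section \<open>Orthomodular lattices\<close>

text \<open>Meets, joins and bounds are determined by the order, so a bijection that preserves and
  reflects it carries them over, and the axioms with them. It is applied to the interval, whose
  definition gives formulas only for the order and the complement.\<close>

lemma (in orthomodular_lattice) order_iso_transport:
  fixes Y :: "('y, 'z) ortho_order_scheme" (structure)
  assumes bij: "bij_betw f (carrier L) (carrier Y)"
    and eq: "(.=\<^bsub>Y\<^esub>) = (=)"
    and le: "\<And>x y. x \<in> carrier L \<Longrightarrow> y \<in> carrier L \<Longrightarrow> f x \<sqsubseteq>\<^bsub>Y\<^esub> f y \<longleftrightarrow> x \<sqsubseteq> y"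
    and ocomp: "\<And>x. x \<in> carrier L \<Longrightarrow> \<midarrow>\<^bsub>Y\<^esub> f x = f (\<midarrow> x)"
  shows "orthomodular_lattice Y" "f \<in> oml_iso L Y"
proof -
  have img: "f ` carrier L = carrier Y" using bij by (simp add: bij_betw_def)
  have elim: "\<exists>x\<in>carrier L. y = f x" if "y \<in> carrier Y" for y using that img by blast
  have mem: "f x \<in> carrier Y" if "x \<in> carrier L" for x using that img by blast
  have inj: "f x = f y \<longleftrightarrow> x = y" if "x \<in> carrier L" "y \<in> carrier L" for x y
    using that bij by (auto simp: bij_betw_def inj_on_def)
  interpret Y: partial_order Y
    by unfold_locales
      (auto simp: eq inj le dest!: elim intro: le_refl le_antisym le_trans)
  have lub: "least Y (f (x \<squnion> y)) (Upper Y {f x, f y})" if "x \<in> carrier L" "y \<in> carrier L" for x y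
    using that
    by (auto simp: least_def Upper_def mem le join_left join_right dest!: elim intro!: join_le)
  have glb: "greatest Y (f (x \<sqinter> y)) (Lower Y {f x, f y})" if "x \<in> carrier L" "y \<in> carrier L" for x y
    using that
    by (auto simp: greatest_def Lower_def mem le meet_left meet_right dest!: elim intro!: meet_le)
  interpret Y: lattice Y
    by unfold_locales (use lub glb in \<open>blast dest!: elim\<close>)+
  \<comment> \<open>The join is a choice among least upper bounds. \<open>Y.joinI\<close> passes
    from a property of all of them to the chosen one, and uniqueness identifies it with the
    transported bound.\<close>
  have join: "f x \<squnion>\<^bsub>Y\<^esub> f y = f (x \<squnion> y)" if "x \<in> carrier L" "y \<in> carrier L" for x y
    using Y.joinI[of "f x" "f y" "\<lambda>l. l = f (x \<squnion> y)"] Y.least_unique[OF _ lub[OF that]] that mem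
    by blast
  have meet: "f x \<sqinter>\<^bsub>Y\<^esub> f y = f (x \<sqinter> y)" if "x \<in> carrier L" "y \<in> carrier L" for x y
    using Y.meetI[of "f x" "f y" "\<lambda>l. l = f (x \<sqinter> y)"] Y.greatest_unique[OF _ glb[OF that]] that mem
    by blast
  have bot: "least Y (f \<bottom>) (carrier Y)" and top: "greatest Y (f \<top>) (carrier Y)"
    by (auto simp: least_def greatest_def mem le dest!: elim)
  interpret Y: bounded_lattice Y
    by unfold_locales (use bot top in blast)+
  have bottom: "\<bottom>\<^bsub>Y\<^esub> = f \<bottom>" and top: "\<top>\<^bsub>Y\<^esub> = f \<top>"
    using bot top by (auto simp: least_def greatest_def intro!: Y.bottom_eq[symmetric] Y.top_eq[symmetric])
  show "orthomodular_lattice Y"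
    by unfold_locales
      (auto dest!: elim simp: mem inj le ocomp join meet bottom top ocomp_closed ocomp_involution
        ocomp_antimono meet_ocomp join_ocomp orthomodular)
  show "f \<in> oml_iso L Y"
    unfolding oml_iso_def join_pres_def meet_pres_def
    using bij join meet ocomp Y.lattice_axioms lattice_axioms by auto
qed

context orthomodular_lattice
begin

lemma ocomp_bottom: "\<midarrow> \<bottom> = \<top>"
proof (rule top_eq)
  show "\<midarrow> \<bottom> \<in> carrier L" by (simp add: ocomp_closed)
  show "x \<sqsubseteq> \<midarrow> \<bottom>" if "x \<in> carrier L" for x
    using ocomp_antimono[of \<bottom> "\<midarrow> x"] that by (simp add: ocomp_closed ocomp_involution)
qed

lemma ocomp_top: "\<midarrow> \<top> = \<bottom>"
  using ocomp_bottom ocomp_involution[of \<bottom>] by simp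

lemma ocomp_join:
  assumes "x \<in> carrier L" "y \<in> carrier L"
  shows "\<midarrow> (x \<squnion> y) = \<midarrow> x \<sqinter> \<midarrow> y"
proof (rule le_antisym)
  note c = assms ocomp_closed meet_closed join_closed
  show "\<midarrow> (x \<squnion> y) \<sqsubseteq> \<midarrow> x \<sqinter> \<midarrow> y"
    by (intro meet_le ocomp_antimono join_left join_right c)
  have "x \<sqsubseteq> \<midarrow> (\<midarrow> x \<sqinter> \<midarrow> y)"
    using ocomp_antimono[of "\<midarrow> x \<sqinter> \<midarrow> y" "\<midarrow> x"] c by (simp add: meet_left ocomp_involution)
  moreover have "y \<sqsubseteq> \<midarrow> (\<midarrow> x \<sqinter> \<midarrow> y)"
    using ocomp_antimono[of "\<midarrow> x \<sqinter> \<midarrow> y" "\<midarrow> y"] c by (simp add: meet_right ocomp_involution)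
  ultimately have "x \<squnion> y \<sqsubseteq> \<midarrow> (\<midarrow> x \<sqinter> \<midarrow> y)"
    using c by (intro join_le) simp_all
  then show "\<midarrow> x \<sqinter> \<midarrow> y \<sqsubseteq> \<midarrow> (x \<squnion> y)"
    using ocomp_antimono[of "x \<squnion> y" "\<midarrow> (\<midarrow> x \<sqinter> \<midarrow> y)"] c by (simp add: ocomp_involution)
qed (use assms in \<open>simp_all add: ocomp_closed\<close>)

lemma ocomp_meet:
  assumes "x \<in> carrier L" "y \<in> carrier L"
  shows "\<midarrow> (x \<sqinter> y) = \<midarrow> x \<squnion> \<midarrow> y"
  using ocomp_join[of "\<midarrow> x" "\<midarrow> y"] assms
  by (metis join_closed ocomp_closed ocomp_involution)

text \<open>The orthomodular law for the complements of \<open>y\<close> and \<open>x\<close>, read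
  through De Morgan.\<close>

lemma orthomodular_dual:
  assumes "x \<in> carrier L" "y \<in> carrier L" "x \<sqsubseteq> y"
  shows "y \<sqinter> (\<midarrow> y \<squnion> x) = x"
proof -
  have "\<midarrow> y \<squnion> (\<midarrow> (\<midarrow> y) \<sqinter> \<midarrow> x) = \<midarrow> x"
    using assms by (intro orthomodular ocomp_closed ocomp_antimono)
  then have "\<midarrow> (\<midarrow> y \<squnion> (\<midarrow> (\<midarrow> y) \<sqinter> \<midarrow> x)) = x"
    using assms by (simp add: ocomp_involution)
  then show ?thesis
    using assms by (simp add: ocomp_join ocomp_meet ocomp_closed ocomp_involution)
qed


section \<open>The structure group\<close>

lemma structure_gen_closed [simp]:
  "x \<in> carrier L \<Longrightarrow> structure_gen L x \<in> carrier (structure_group L)"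
  by (simp add: structure_gen_def structure_group_def presented_group_def)

lemma structure_gen_mult:
  assumes "x \<in> carrier L" "y \<in> carrier L" "\<midarrow> x \<sqsubseteq> y"
  shows "structure_gen L x \<otimes>\<^bsub>structure_group L\<^esub> structure_gen L y = structure_gen L (x \<sqinter> y)"
proof -
  have "pres_eq (carrier L) (structure_relations L) [(x, True), (y, True)] [(x \<sqinter> y, True)]"
    using assms by (intro pres_rel) (auto simp: structure_relations_def)
  then show ?thesis
    using assms by (simp add: structure_gen_def structure_group_def presented_group_mult pres_class_eq_iff)
qed

text \<open>Since \<top> \<sqinter> \<top> = \<top> gives one of the defining relations, the
  generator is idempotent, and the only idempotent of a group is its identity.\<close>

lemma structure_gen_top: "structure_gen L \<top> = \<one>\<^bsub>structure_group L\<^esub>"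
proof -
  interpret G: group "structure_group L" by (rule group_structure_group)
  have "\<top> \<sqinter> \<top> = \<top>" by (rule le_antisym) (auto intro: meet_left meet_le)
  then have "structure_gen L \<top> \<otimes>\<^bsub>structure_group L\<^esub> structure_gen L \<top> = structure_gen L \<top>"
    using structure_gen_mult[of \<top> \<top>] by (simp add: ocomp_top)
  then show ?thesis using G.l_cancel_one[of "structure_gen L \<top>" "structure_gen L \<top>"] by simp
qed

lemma structure_gen_ocomp:
  assumes "x \<in> carrier L"
  shows "structure_gen L x \<otimes>\<^bsub>structure_group L\<^esub> structure_gen L (\<midarrow> x) = structure_gen L \<bottom>"
    and "structure_gen L (\<midarrow> x) \<otimes>\<^bsub>structure_group L\<^esub> structure_gen L x = structure_gen L \<bottom>"
  using assms structure_gen_mult[of x "\<midarrow> x"] structure_gen_mult[of "\<midarrow> x" x] meet_comm[of L x "\<midarrow> x"]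
  by (simp_all add: ocomp_closed ocomp_involution meet_ocomp)

text \<open>With x' the complement of x and 0 the bottom, x x' = x' x = 0 in the group, so x 0 = x
  (x' x) = (x x') x = 0 x.\<close>

lemma structure_gen_bottom_central:
  assumes "x \<in> carrier L"
  shows "structure_gen L x \<otimes>\<^bsub>structure_group L\<^esub> structure_gen L \<bottom> =
    structure_gen L \<bottom> \<otimes>\<^bsub>structure_group L\<^esub> structure_gen L x"
proof -
  interpret G: group "structure_group L" by (rule group_structure_group)
  show ?thesis
    using assms by (metis G.m_assoc structure_gen_ocomp structure_gen_closed ocomp_closed)
qed

text \<open>The left factor on the right-hand side is the Sasaki projection of \<open>y\<close> to \<open>x\<close>.\<close>

lemma structure_gen_mult_sasaki:
  assumes "x \<in> carrier L" "y \<in> carrier L"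
  obtains w where "w \<in> carrier L"
    "structure_gen L x \<otimes>\<^bsub>structure_group L\<^esub> structure_gen L y =
     structure_gen L (x \<sqinter> (\<midarrow> x \<squnion> y)) \<otimes>\<^bsub>structure_group L\<^esub> structure_gen L w"
proof
  interpret G: group "structure_group L" by (rule group_structure_group)
  \<comment> \<open>\<open>?y\<close> lies above the complement of \<open>x\<close>, so the product
    of \<open>x\<close> and \<open>?y\<close> is their meet. \<open>?w\<close> is the element for
    which the dual orthomodular law factors \<open>y\<close> as
    \<open>?y \<sqinter> ?w\<close>.\<close>
  let ?y = "\<midarrow> x \<squnion> y" and ?w = "\<midarrow> (\<midarrow> x \<squnion> y) \<squnion> y"
  have c: "\<midarrow> x \<in> carrier L" "?y \<in> carrier L" "\<midarrow> ?y \<in> carrier L" "?w \<in> carrier L"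
    using assms by (simp_all add: ocomp_closed)
  show "?w \<in> carrier L" by (rule c)
  have "?y \<sqinter> ?w = y" using assms c by (intro orthomodular_dual join_right)
  then have "structure_gen L ?y \<otimes>\<^bsub>structure_group L\<^esub> structure_gen L ?w = structure_gen L y"
    using assms c structure_gen_mult[of ?y ?w] join_left[of "\<midarrow> ?y" y] by simp
  moreover have "structure_gen L x \<otimes>\<^bsub>structure_group L\<^esub> structure_gen L ?y = structure_gen L (x \<sqinter> ?y)"
    using assms c by (intro structure_gen_mult join_left)
  ultimately show "structure_gen L x \<otimes>\<^bsub>structure_group L\<^esub> structure_gen L y =
     structure_gen L (x \<sqinter> (\<midarrow> x \<squnion> y)) \<otimes>\<^bsub>structure_group L\<^esub> structure_gen L ?w"
    using assms c by (metis G.m_assoc structure_gen_closed)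
qed

section \<open>Products of generators and the clearing of inverses\<close>

inductive_set structure_monoid :: "'a word set set"
  where
    one: "\<one>\<^bsub>structure_group L\<^esub> \<in> structure_monoid"
  | gen: "x \<in> carrier L \<Longrightarrow> p \<in> structure_monoid \<Longrightarrow>
      structure_gen L x \<otimes>\<^bsub>structure_group L\<^esub> p \<in> structure_monoid"

lemma structure_monoid_closed: "p \<in> structure_monoid \<Longrightarrow> p \<in> carrier (structure_group L)"
proof (induction rule: structure_monoid.induct)
  interpret G: group "structure_group L" by (rule group_structure_group)
  case one
  show ?case by simp
next
  interpret G: group "structure_group L" by (rule group_structure_group)
  case (gen x p)
  then show ?case by simp
qed

lemma bottom_pow_structure_monoid:
  "structure_gen L \<bottom> [^]\<^bsub>structure_group L\<^esub> (n::nat) \<in> structure_monoid"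
proof -
  interpret G: group "structure_group L" by (rule group_structure_group)
  show ?thesis
  proof (induction n)
    case (Suc n)
    have "structure_gen L \<bottom> [^]\<^bsub>structure_group L\<^esub> Suc n =
        structure_gen L \<bottom> \<otimes>\<^bsub>structure_group L\<^esub> structure_gen L \<bottom> [^]\<^bsub>structure_group L\<^esub> n"
      by (rule G.nat_pow_Suc2) simp
    then show ?case using structure_monoid.gen[OF _ Suc] by simp
  qed (simp add: structure_monoid.one)
qed

text \<open>The inverse of \<open>x\<close> times the generator \<bottom> is the complement of
  \<open>x\<close>, so each inverse letter is removed at the cost of one factor \<bottom>. These
  factors are central and can be collected on the left, which gives an induction on words.\<close>

lemma structure_group_fractions:
  assumes "g \<in> carrier (structure_group L)"
  shows "\<exists>n::nat. structure_gen L \<bottom> [^]\<^bsub>structure_group L\<^esub> n \<otimes>\<^bsub>structure_group L\<^esub> g \<in> structure_monoid"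
proof -
  interpret G: group "structure_group L" by (rule group_structure_group)
  let ?G = "structure_group L" and ?z = "structure_gen L \<bottom>"
    and ?c = "pres_class (carrier L) (structure_relations L)"
  have z [simp]: "?z \<in> carrier ?G" by simp
  have carr: "carrier ?G = ?c ` words (carrier L)"
    by (simp add: structure_group_def presented_group_def)
  have comm: "?z [^]\<^bsub>?G\<^esub> (n::nat) \<otimes>\<^bsub>?G\<^esub> structure_gen L x = structure_gen L x \<otimes>\<^bsub>?G\<^esub> ?z [^]\<^bsub>?G\<^esub> n"
    if "x \<in> carrier L" for n x
  proof (induction n)
    case (Suc n)
    have "?z [^]\<^bsub>?G\<^esub> Suc n \<otimes>\<^bsub>?G\<^esub> structure_gen L x = (?z [^]\<^bsub>?G\<^esub> n \<otimes>\<^bsub>?G\<^esub> structure_gen L x) \<otimes>\<^bsub>?G\<^esub> ?z"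
      using that structure_gen_bottom_central[OF that] by (simp add: G.m_assoc)
    then show ?case using that by (simp add: Suc G.m_assoc)
  qed (use that in simp)
  have "\<exists>n::nat. ?z [^]\<^bsub>?G\<^esub> n \<otimes>\<^bsub>?G\<^esub> ?c u \<in> structure_monoid" if "u \<in> words (carrier L)" for u
    using that
  proof (induction u rule: list.induct)
    case Nil
    have "?c [] = \<one>\<^bsub>?G\<^esub>" by (simp add: structure_group_def presented_group_def)
    then have "?z [^]\<^bsub>?G\<^esub> (0::nat) \<otimes>\<^bsub>?G\<^esub> ?c [] \<in> structure_monoid"
      by (simp add: structure_monoid.one)
    then show ?case ..
  next
    case (Cons a u)
    obtain x e where a: "a = (x, e)" by (cases a)
    have x: "x \<in> carrier L" and u: "u \<in> words (carrier L)" using Cons.prems a by simp_all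
    have cu: "?c u \<in> carrier ?G" "?c [(x, e)] \<in> carrier ?G" for e
      using u x unfolding carr by auto
    have split: "?c (a # u) = ?c [(x, e)] \<otimes>\<^bsub>?G\<^esub> ?c u"
      using x u presented_group_mult[of "[(x, e)]" "carrier L" u "structure_relations L"]
      by (simp add: a structure_group_def)
    obtain n :: nat where n: "?z [^]\<^bsub>?G\<^esub> n \<otimes>\<^bsub>?G\<^esub> ?c u \<in> structure_monoid"
      using Cons.IH[OF u] by blast
    show ?case
    proof (cases e)
      case True
      then have c: "?c [(x, e)] = structure_gen L x" by (simp add: structure_gen_def)
      have "?z [^]\<^bsub>?G\<^esub> n \<otimes>\<^bsub>?G\<^esub> ?c (a # u) =
          structure_gen L x \<otimes>\<^bsub>?G\<^esub> (?z [^]\<^bsub>?G\<^esub> n \<otimes>\<^bsub>?G\<^esub> ?c u)"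
        unfolding split c using x cu comm[OF x] by (simp flip: G.m_assoc)
      then show ?thesis using structure_monoid.gen[OF x n] by metis
    next
      case False
      have "?c [(x, e)] \<otimes>\<^bsub>?G\<^esub> structure_gen L x = \<one>\<^bsub>?G\<^esub>"
        using x False pres_cancel[OF x, of "structure_relations L" False]
          presented_group_mult[of "[(x, False)]" "carrier L" "[(x, True)]" "structure_relations L"]
        by (simp add: structure_gen_def structure_group_def pres_class_eq_iff)
          (simp add: presented_group_def pres_class_eq_iff)
      then have "structure_gen L (\<midarrow> x) = ?c [(x, e)] \<otimes>\<^bsub>?G\<^esub> structure_gen L x \<otimes>\<^bsub>?G\<^esub> structure_gen L (\<midarrow> x)"
        using x by (simp add: ocomp_closed)
      also have "\<dots> = ?c [(x, e)] \<otimes>\<^bsub>?G\<^esub> ?z"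
        using x cu by (simp add: G.m_assoc structure_gen_ocomp ocomp_closed)
      finally have c: "structure_gen L (\<midarrow> x) = ?c [(x, e)] \<otimes>\<^bsub>?G\<^esub> ?z" .
      \<comment> \<open>Centrality of \<open>?z\<close> is known only against generators. It is
        applied to the complement of \<open>x\<close>, and cancelling \<open>?z\<close> on the right
        moves \<open>?z\<close> past the inverse letter.\<close>
      have "?z \<otimes>\<^bsub>?G\<^esub> (?c [(x, e)] \<otimes>\<^bsub>?G\<^esub> ?z) = ?c [(x, e)] \<otimes>\<^bsub>?G\<^esub> ?z \<otimes>\<^bsub>?G\<^esub> ?z"
        using c structure_gen_bottom_central[of "\<midarrow> x"] x by (simp add: ocomp_closed)
      then have "?z \<otimes>\<^bsub>?G\<^esub> ?c [(x, e)] \<otimes>\<^bsub>?G\<^esub> ?z = ?c [(x, e)] \<otimes>\<^bsub>?G\<^esub> ?z \<otimes>\<^bsub>?G\<^esub> ?z"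
        using cu by (simp add: G.m_assoc)
      then have c': "?z \<otimes>\<^bsub>?G\<^esub> ?c [(x, e)] = structure_gen L (\<midarrow> x)"
        unfolding c using cu by simp
      have "?z [^]\<^bsub>?G\<^esub> Suc n \<otimes>\<^bsub>?G\<^esub> ?c (a # u) = ?z [^]\<^bsub>?G\<^esub> n \<otimes>\<^bsub>?G\<^esub> (?z \<otimes>\<^bsub>?G\<^esub> ?c [(x, e)]) \<otimes>\<^bsub>?G\<^esub> ?c u"
        unfolding split using cu by (simp add: G.m_assoc)
      also have "\<dots> = structure_gen L (\<midarrow> x) \<otimes>\<^bsub>?G\<^esub> (?z [^]\<^bsub>?G\<^esub> n \<otimes>\<^bsub>?G\<^esub> ?c u)"
        unfolding c' using x cu comm[OF ocomp_closed[OF x]] by (simp add: G.m_assoc[symmetric] ocomp_closed)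
      finally show ?thesis using structure_monoid.gen[OF ocomp_closed[OF x] n] by metis
    qed
  qed
  then show ?thesis using assms unfolding carr by blast
qed

end


section \<open>Orthogonal projections\<close>

context anisotropic_form
begin

lemma form_add [simp]: "b (v + v') w = b v w + b v' w" "b v (w + w') = b v w + b v w'"
proof -
  interpret r: Vector_Spaces.linear scale "(*)" "\<lambda>w. b v w" by (rule linear_right)
  interpret l: Vector_Spaces.linear scale "(*)" "\<lambda>v. b v w" by (rule linear_left)
  show "b (v + v') w = b v w + b v' w" "b v (w + w') = b v w + b v w'" by (rule l.add, rule r.add)
qed

lemma form_diff [simp]: "b (v - v') w = b v w - b v' w" "b v (w - w') = b v w - b v w'"
proof -
  have "b (v - v') w + b v' w = b v w" "b v (w - w') + b v w' = b v w"
    by (simp_all only: form_add[symmetric] diff_add_cancel)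
  then show "b (v - v') w = b v w - b v' w" "b v (w - w') = b v w - b v w'"
    by (simp_all add: eq_diff_eq)
qed

lemma form_scale [simp]: "b (scale a v) w = a * b v w" "b v (scale a w) = a * b v w"
proof -
  interpret r: Vector_Spaces.linear scale "(*)" "\<lambda>w. b v w" by (rule linear_right)
  interpret l: Vector_Spaces.linear scale "(*)" "\<lambda>v. b v w" by (rule linear_left)
  show "b (scale a v) w = a * b v w" "b v (scale a w) = a * b v w" by (rule l.scale, rule r.scale)
qed

definition orth :: "'v set \<Rightarrow> 'v set"
  where "orth U = {v. \<forall>u\<in>U. b u v = 0}"

lemma subspace_orth [simp]: "subspace (orth U)"
  by (rule subspaceI) (auto simp: orth_def)

lemma orth_antimono: "U \<subseteq> W \<Longrightarrow> orth W \<subseteq> orth U"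
  by (auto simp: orth_def)

lemma orth_span: "orth (span S) = orth S"
proof (rule subset_antisym)
  show "orth (span S) \<subseteq> orth S" by (rule orth_antimono) (rule span_superset)
  show "orth S \<subseteq> orth (span S)"
  proof
    fix v assume v: "v \<in> orth S"
    have "subspace {u. b u v = 0}" by (rule subspaceI) auto
    then have "span S \<subseteq> {u. b u v = 0}" using v by (intro span_minimal) (auto simp: orth_def)
    then show "v \<in> orth (span S)" by (auto simp: orth_def)
  qed
qed

lemma orth_disjoint: "x \<in> U \<Longrightarrow> x \<in> orth U \<Longrightarrow> x = 0"
  using anisotropic by (auto simp: orth_def)

text \<open>Gram-Schmidt: the step adds the component along the part of the new vector orthogonal to \<open>S\<close>.\<close>

lemma projection_exists_span:
  assumes "finite S"
  shows "\<exists>y\<in>span S. x - y \<in> orth (span S)"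
  using assms
proof (induction S arbitrary: x rule: finite_induct)
  case empty
  then show ?case by (auto simp: orth_def)
next
  case (insert a S)
  obtain a' where a': "a' \<in> span S" "a - a' \<in> orth (span S)" using insert.IH by blast
  obtain y where y: "y \<in> span S" "x - y \<in> orth (span S)" using insert.IH by blast
  \<comment> \<open>The Fourier coefficient of \<open>x\<close> along \<open>a - a'\<close>. If
    \<open>a = a'\<close>, division by zero yields 0 and the product formula below still holds;
    otherwise anisotropy makes the denominator nonzero.\<close>
  define c where "c = b (a - a') x / b (a - a') (a - a')"
  have c: "b (a - a') x = c * b (a - a') (a - a')"
    by (cases "a - a' = 0") (auto simp add: c_def anisotropic simp del: form_diff)
  have orth0: "b u (a - a') = 0" "b (a - a') u = 0" "b u (x - y) = 0" if "u \<in> span S" for u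
    using that a'(2) y(2) symmetric by (auto simp: orth_def simp del: form_diff)
  have sub: "span S \<subseteq> span (insert a S)" by (rule span_mono) auto
  have "y + scale c (a - a') \<in> span (insert a S)"
    using a' y sub by (intro span_add span_scale span_diff) (auto intro: span_base)
  \<comment> \<open>By \<open>orth_span\<close> it suffices to test against
    \<open>insert a S\<close>; the new vector is split as \<open>a = (a - a') + a'\<close>, with
    \<open>a'\<close> in the span of \<open>S\<close>.\<close>
  moreover have "x - (y + scale c (a - a')) \<in> orth (insert a S)"
  proof -
    have xz: "x - (y + scale c (a - a')) = (x - y) - scale c (a - a')" by simp
    have S: "b u (x - (y + scale c (a - a'))) = 0" if "u \<in> span S" for u
      unfolding xz form_diff(2)[of _ "x - y"] form_scale using orth0[OF that] by simp
    have "b (a - a') (x - (y + scale c (a - a'))) = 0"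
      unfolding form_diff(2) form_add(2) form_scale(2)[of "a - a'" c] orth0(2)[OF y(1)] c by simp
    moreover have "b a' (x - (y + scale c (a - a'))) = 0" by (rule S) (rule a')
    ultimately have "b a (x - (y + scale c (a - a'))) = 0"
      using form_add(1)[of "a - a'" a' "x - (y + scale c (a - a'))"]
      by (simp del: form_diff form_add)
    then show ?thesis using S by (auto simp: orth_def span_base simp del: form_diff form_add)
  qed
  ultimately show ?case unfolding orth_span by blast
qed

lemma projection_exists:
  assumes "subspace U"
  shows "\<exists>y\<in>U. x - y \<in> orth U"
proof -
  obtain S where S: "S \<subseteq> U" "independent S" "U \<subseteq> span S" by (rule maximal_independent_subset)
  have "span S = U" using S assms by (metis span_minimal subset_antisym)
  then show ?thesis using projection_exists_span[OF finiteI_independent[OF S(2)], of x] by simp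
qed

definition proj :: "'v set \<Rightarrow> 'v \<Rightarrow> 'v"
  where "proj U x = (THE y. y \<in> U \<and> x - y \<in> orth U)"

text \<open>Two candidates differ by a vector lying in both \<open>U\<close> and
  \<open>orth U\<close>, which is zero by anisotropy. Values of \<open>proj\<close> are computed
  below by this rule.\<close>

lemma proj_eqI:
  assumes "subspace U" "y \<in> U" "x - y \<in> orth U"
  shows "proj U x = y"
  unfolding proj_def
proof (rule the_equality)
  fix z assume z: "z \<in> U \<and> x - z \<in> orth U"
  then have "z - y \<in> U" using assms by (simp add: subspace_diff)
  moreover have "(x - y) - (x - z) \<in> orth U" using z assms subspace_diff[OF subspace_orth] by blast
  ultimately have "z - y = 0" by (intro orth_disjoint[of _ U]) simp_all
  then show "z = y" by simp
qed (use assms in simp)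

lemma proj_mem: assumes "subspace U" shows "proj U x \<in> U" "x - proj U x \<in> orth U"
  using projection_exists[OF assms, of x] proj_eqI[OF assms] by auto

lemma proj_add: "subspace U \<Longrightarrow> proj U (x + y) = proj U x + proj U y"
proof (rule proj_eqI)
  assume U: "subspace U"
  then show "proj U x + proj U y \<in> U" by (simp add: proj_mem subspace_add)
  have "(x - proj U x) + (y - proj U y) \<in> orth U" using U by (intro subspace_add proj_mem) auto
  then show "x + y - (proj U x + proj U y) \<in> orth U" by (simp add: algebra_simps)
qed

lemma proj_scale: "subspace U \<Longrightarrow> proj U (scale a x) = scale a (proj U x)"
proof (rule proj_eqI)
  assume U: "subspace U"
  then show "scale a (proj U x) \<in> U" by (simp add: proj_mem subspace_scale)
  have "scale a (x - proj U x) \<in> orth U" using U by (intro subspace_scale proj_mem) auto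
  then show "scale a x - scale a (proj U x) \<in> orth U" by (simp add: scale_right_diff_distrib)
qed

lemma proj_zero [simp]: "subspace U \<Longrightarrow> proj U 0 = 0"
  using proj_scale[of U 0 0] by simp

lemma proj_id: "subspace U \<Longrightarrow> x \<in> U \<Longrightarrow> proj U x = x"
  by (rule proj_eqI) (auto simp: orth_def)

lemma proj_orth_zero: "subspace U \<Longrightarrow> x \<in> orth U \<Longrightarrow> proj U x = 0"
  by (rule proj_eqI) (auto simp: subspace_0)

text \<open>For \<open>x\<close> in the double complement, \<open>x - proj U x\<close> lies in both
  \<open>orth U\<close> and \<open>orth (orth U)\<close>, hence vanishes, and \<open>x\<close>
  equals its projection to \<open>U\<close>.\<close>

lemma orth_orth [simp]: assumes "subspace U" shows "orth (orth U) = U"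
proof (rule subset_antisym)
  show U: "U \<subseteq> orth (orth U)" using symmetric by (auto simp: orth_def)
  show "orth (orth U) \<subseteq> U"
  proof
    fix x assume "x \<in> orth (orth U)"
    then have "x - proj U x \<in> orth (orth U)" using U proj_mem[OF assms] by (intro subspace_diff) auto
    then have "x - proj U x = 0" using proj_mem[OF assms] by (intro orth_disjoint)
    then show "x \<in> U" using proj_mem(1)[OF assms, of x] by simp
  qed
qed

lemma proj_orth: assumes "subspace U" shows "proj (orth U) x = x - proj U x"
  by (rule proj_eqI) (use assms proj_mem in \<open>simp_all\<close>)

lemma form_proj_orth:
  assumes "subspace U"
  shows "b (proj U x) (y - proj U y) = 0" "b (y - proj U y) (proj U x) = 0"
  using proj_mem[OF assms] symmetric by (auto simp: orth_def simp del: form_diff)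

section \<open>The lattice of subspaces\<close>

abbreviation subspaces :: "'v set ortho_order"
  where "subspaces \<equiv> subspace_lattice scale b"

lemma subspaces_simps [simp]:
  "carrier subspaces = {U. subspace U}" "(.=\<^bsub>subspaces\<^esub>) = (=)"
  "U \<sqsubseteq>\<^bsub>subspaces\<^esub> W \<longleftrightarrow> U \<subseteq> W" "\<midarrow>\<^bsub>subspaces\<^esub> U = orth U"
  by (simp_all add: subspace_lattice_def orth_def)

text \<open>The decomposition of \<open>x\<close> into \<open>proj U x\<close> and
  \<open>x - proj U x\<close> shows that \<open>U\<close> and \<open>orth U\<close> span the whole
  space. If \<open>U \<subseteq> W\<close> and \<open>x \<in> W\<close>, the second summand stays in
  \<open>W\<close>, which is the orthomodular law.\<close>

lemma orthomodular_lattice_subspaces: "orthomodular_lattice subspaces"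
proof -
  interpret partial_order subspaces
    by unfold_locales auto
  have lub: "least subspaces {u + w | u w. u \<in> U \<and> w \<in> W} (Upper subspaces {U, W})"
    if "subspace U" "subspace W" for U W
  proof -
    have "U \<subseteq> {u + w | u w. u \<in> U \<and> w \<in> W}" "W \<subseteq> {u + w | u w. u \<in> U \<and> w \<in> W}"
      using subspace_0[OF that(1)] subspace_0[OF that(2)]
      by (force intro: exI[of _ 0])+
    moreover have "{u + w | u w. u \<in> U \<and> w \<in> W} \<subseteq> X" if "subspace X" "U \<subseteq> X" "W \<subseteq> X" for X
      using that by (auto intro: subspace_add)
    ultimately show ?thesis
      using that by (auto simp: least_def Upper_def subspace_sums)
  qed
  have glb: "greatest subspaces (U \<inter> W) (Lower subspaces {U, W})" if "subspace U" "subspace W" for U W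
    using that by (auto simp: greatest_def Lower_def subspace_inter)
  interpret bounded_lattice subspaces
  proof unfold_locales
    show "\<exists>s. least subspaces s (Upper subspaces {U, W})"
      if "U \<in> carrier subspaces" "W \<in> carrier subspaces" for U W
      using lub that by auto
    show "\<exists>s. greatest subspaces s (Lower subspaces {U, W})"
      if "U \<in> carrier subspaces" "W \<in> carrier subspaces" for U W
      using glb that by auto
    have "least subspaces {0} (carrier subspaces)" by (auto simp: least_def subspace_0)
    then show "\<exists>B. least subspaces B (carrier subspaces)" ..
    have "greatest subspaces UNIV (carrier subspaces)" by (auto simp: greatest_def)
    then show "\<exists>B. greatest subspaces B (carrier subspaces)" ..
  qed
  have bot: "\<bottom>\<^bsub>subspaces\<^esub> = {0}" by (rule bottom_eq[symmetric]) (auto simp: subspace_0)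
  have top: "\<top>\<^bsub>subspaces\<^esub> = UNIV" by (rule top_eq[symmetric]) auto
  have dec: "\<exists>u w. x = u + w \<and> u \<in> U \<and> w \<in> orth U" if "subspace U" for U x
    using proj_mem[OF that, of x] by (intro exI[of _ "proj U x"] exI[of _ "x - proj U x"]) simp
  show ?thesis
  proof unfold_locales
    fix U assume "U \<in> carrier subspaces"
    then have U: "subspace U" by simp
    show "\<midarrow>\<^bsub>subspaces\<^esub> U \<in> carrier subspaces" by simp
    show "\<midarrow>\<^bsub>subspaces\<^esub> (\<midarrow>\<^bsub>subspaces\<^esub> U) = U" using U by simp
    show "U \<sqinter>\<^bsub>subspaces\<^esub> \<midarrow>\<^bsub>subspaces\<^esub> U = \<bottom>\<^bsub>subspaces\<^esub>"
      using U by (auto simp: subspace_lattice_meet bot subspace_0 intro: orth_disjoint)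
    show "U \<squnion>\<^bsub>subspaces\<^esub> \<midarrow>\<^bsub>subspaces\<^esub> U = \<top>\<^bsub>subspaces\<^esub>"
      using U dec[OF U] by (auto simp: subspace_lattice_join top)
    fix W assume "W \<in> carrier subspaces"
    then have W: "subspace W" by simp
    assume "U \<sqsubseteq>\<^bsub>subspaces\<^esub> W"
    then have UW: "U \<subseteq> W" by simp
    then show "\<midarrow>\<^bsub>subspaces\<^esub> W \<sqsubseteq>\<^bsub>subspaces\<^esub> \<midarrow>\<^bsub>subspaces\<^esub> U" by (simp add: orth_antimono)
    have "w - proj U w \<in> orth U \<inter> W" if "w \<in> W" for w
      using that UW W proj_mem[OF U, of w] by (auto intro: subspace_diff)
    then have "\<exists>u w'. w = u + w' \<and> u \<in> U \<and> w' \<in> orth U \<inter> W" if "w \<in> W" for w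
      using that proj_mem(1)[OF U, of w]
      by (intro exI[of _ "proj U w"] exI[of _ "w - proj U w"]) simp
    then show "U \<squnion>\<^bsub>subspaces\<^esub> (\<midarrow>\<^bsub>subspaces\<^esub> U \<sqinter>\<^bsub>subspaces\<^esub> W) = W"
      using U W UW
      by (auto simp: subspace_lattice_meet subspace_lattice_join subspace_inter intro: subspace_add)
  qed
qed

lemma top_subspaces: "\<top>\<^bsub>subspaces\<^esub> = UNIV"
proof -
  interpret orthomodular_lattice subspaces by (rule orthomodular_lattice_subspaces)
  show ?thesis by (rule top_eq[symmetric]) auto
qed

text \<open>The Sasaki projection of the lattice of subspaces is given by orthogonal projection.\<close>

lemma proj_image:
  assumes "subspace U" "subspace W"
  shows "proj U ` W = U \<sqinter>\<^bsub>subspaces\<^esub> (\<midarrow>\<^bsub>subspaces\<^esub> U \<squnion>\<^bsub>subspaces\<^esub> W)"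
proof -
  have "proj U w \<in> {u + w' | u w'. u \<in> orth U \<and> w' \<in> W}" if "w \<in> W" for w
  proof -
    have "proj U w = - (w - proj U w) + w" by simp
    then show ?thesis using that proj_mem[OF assms(1), of w] subspace_neg[OF subspace_orth] by blast
  qed
  moreover have "u + w \<in> proj U ` W" if "u \<in> orth U" "w \<in> W" "u + w \<in> U" for u w
  proof -
    \<comment> \<open>The difference \<open>w - (u + w) = - u\<close> is orthogonal to
      \<open>U\<close>, so a vector \<open>u + w\<close> in \<open>U\<close> is already the
      projection of \<open>w\<close>.\<close>
    have "proj U w = u + w"
      using that subspace_neg[OF subspace_orth, of u U] by (intro proj_eqI assms) simp_all
    then show ?thesis using that by force
  qed
  ultimately show ?thesis
    using assms
    by (auto simp: subspace_lattice_join subspace_lattice_meet subspace_sums proj_mem)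
qed


section \<open>The embedding of the lattice of subspaces\<close>

definition map_proj :: "'v set \<Rightarrow> (int \<Rightarrow>\<^sub>0 'v) \<Rightarrow> (int \<Rightarrow>\<^sub>0 'v)"
  where "map_proj U = Poly_Mapping.map (proj U)"

definition emb :: "'v set \<Rightarrow> (int \<Rightarrow>\<^sub>0 'v) \<Rightarrow> (int \<Rightarrow>\<^sub>0 'v)"
  where "emb U v = map_proj U v + t_inv scale (v - map_proj U v)"

lemma lookup_map_proj:
  "subspace U \<Longrightarrow> Poly_Mapping.lookup (map_proj U v) n = proj U (Poly_Mapping.lookup v n)"
  by (auto simp: map_proj_def map.rep_eq when_def)

lemma lookup_t_inv: "Poly_Mapping.lookup (t_inv scale v) n = Poly_Mapping.lookup v (n + 1)"
  by (simp add: t_inv_def lookup_laurent_shift)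

lemma lookup_emb:
  "subspace U \<Longrightarrow> Poly_Mapping.lookup (emb U v) n =
    proj U (Poly_Mapping.lookup v n) + (Poly_Mapping.lookup v (n + 1) - proj U (Poly_Mapping.lookup v (n + 1)))"
  by (simp add: emb_def lookup_add lookup_minus lookup_map_proj lookup_t_inv)

lemma emb_add: "subspace U \<Longrightarrow> emb U (v + w) = emb U v + emb U w"
  by (rule poly_mapping_eqI) (simp add: lookup_emb lookup_add proj_add algebra_simps)

lemma emb_monom:
  "subspace U \<Longrightarrow> emb U (monom j x) = monom j (proj U x) + monom (j - 1) (x - proj U x)"
  by (rule poly_mapping_eqI) (auto simp: lookup_emb lookup_add lookup_single when_def)

lemma laurent_hom_emb: assumes "subspace U" shows "laurent_hom (emb U)"
  unfolding laurent_hom_iff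
proof (intro conjI allI emb_add assms)
  fix p :: "int \<Rightarrow>\<^sub>0 'k" and v :: "int \<Rightarrow>\<^sub>0 'v"
  show "emb U (laurent_scale scale p v) = laurent_scale scale p (emb U v)"
  proof (induction v rule: laurent_induct)
    case (monom j x)
    show ?case
    proof (induction p rule: laurent_induct)
      case (monom i a)
      show ?case
        by (simp add: laurent_scale_monom laurent_scale_add_right emb_monom[OF assms]
            proj_scale[OF assms] scale_right_diff_distrib add_diff_eq)
    qed (simp add: laurent_scale_add_left emb_add[OF assms] add_ac)
  qed (simp add: laurent_scale_add_right emb_add[OF assms])
qed

lemma laurent_form_add:
  "laurent_form b (v + v') w = laurent_form b v w + laurent_form b v' w"
  "laurent_form b v (w + w') = laurent_form b v w + laurent_form b v w'"
  by (rule poly_mapping_eqI,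
      simp add: lookup_laurent_form lookup_add Sum_any.distrib laurent_form_finite(2))+

lemma laurent_form_zero:
  assumes "\<And>i j. b (Poly_Mapping.lookup v i) (Poly_Mapping.lookup w j) = 0"
  shows "laurent_form b v w = 0"
  by (rule poly_mapping_eqI) (simp add: lookup_laurent_form assms)

text \<open>All coefficients of the projected part are orthogonal to all those of the remainder, so
  the cross terms vanish with or without the shift. On the remainder the shift by
  \<open>t^-1\<close> is an isometry.\<close>

lemma laurent_form_emb:
  assumes U: "subspace U"
  shows "laurent_form b (emb U v) (emb U w) = laurent_form b v w"
proof -
  let ?p = "map_proj U" and ?q = "\<lambda>v. v - map_proj U v"
  note look = lookup_map_proj[OF U] lookup_minus lookup_t_inv
  have cross: "laurent_form b (?p v) (?q w) = 0" "laurent_form b (?q v) (?p w) = 0"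
    "laurent_form b (?p v) (t_inv scale (?q w)) = 0" "laurent_form b (t_inv scale (?q v)) (?p w) = 0" for v w
    by (rule laurent_form_zero, simp add: look form_proj_orth[OF U] del: form_diff)+
  have "laurent_form b (emb U v) (emb U w) = laurent_form b (?p v) (?p w) + laurent_form b (?q v) (?q w)"
    unfolding emb_def laurent_form_add cross laurent_form_t_inv by simp
  also have "\<dots> = laurent_form b (?p v + ?q v) (?p w + ?q w)"
    unfolding laurent_form_add cross by simp
  finally show ?thesis by simp
qed

lemma emb_UNIV: "emb UNIV = id"
  by (intro ext poly_mapping_eqI) (simp add: lookup_emb proj_id)

lemma emb_zero: "emb {0} = t_inv scale"
proof (intro ext poly_mapping_eqI)
  fix v n
  have "proj {0} x = 0" for x by (rule proj_eqI) (auto simp: orth_def)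
  then show "Poly_Mapping.lookup (emb {0} v) n = Poly_Mapping.lookup (t_inv scale v) n"
    by (simp add: lookup_emb lookup_t_inv)
qed

text \<open>The hypothesis gives \<open>P_U Q_W = Q_W\<close>. Hence \<open>Q_U Q_W = 0\<close>, so
  no term in \<open>t^-2\<close> occurs, and \<open>P_U P_W = P_U - Q_W\<close> is the projection to
  \<open>U \<inter> W\<close>. This is what makes \<open>emb\<close> respect the relations of the
  structure group.\<close>

lemma emb_comp:
  assumes U: "subspace U" and W: "subspace W" and "orth U \<subseteq> W"
  shows "emb U \<circ> emb W = emb (U \<inter> W)"
proof (intro ext poly_mapping_eqI)
  fix v :: "int \<Rightarrow>\<^sub>0 'v" and n
  have WU: "orth W \<subseteq> U" using orth_antimono[OF assms(3)] U by simp
  have Q: "x - proj W x \<in> U" "x - proj U x \<in> W" for x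
    using proj_mem[OF W] proj_mem[OF U] WU assms(3) by blast+
  have PQ: "proj U (x - proj W x) = x - proj W x" for x
    by (rule proj_id[OF U Q(1)])
  have PP: "proj U (proj W x) = proj U x - (x - proj W x)" for x
    using proj_add[OF U, of "proj W x" "x - proj W x"] PQ[of x] by (simp add: algebra_simps)
  have PI: "proj (U \<inter> W) x = proj U x - (x - proj W x)" for x
  proof (rule proj_eqI)
    have "proj U x - (x - proj W x) \<in> U"
      using proj_mem(1)[OF U] Q(1) by (rule subspace_diff[OF U])
    moreover have "proj W x - (x - proj U x) \<in> W"
      using proj_mem(1)[OF W] Q(2) by (rule subspace_diff[OF W])
    moreover have "proj W x - (x - proj U x) = proj U x - (x - proj W x)" by simp
    ultimately show "proj U x - (x - proj W x) \<in> U \<inter> W" by (metis IntI)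
    have "(x - proj U x) + (x - proj W x) \<in> orth (U \<inter> W)"
      using proj_mem(2)[OF U, of x] proj_mem(2)[OF W, of x]
        orth_antimono[of "U \<inter> W" U] orth_antimono[of "U \<inter> W" W]
      by (intro subspace_add subspace_orth) auto
    then show "x - (proj U x - (x - proj W x)) \<in> orth (U \<inter> W)" by (simp add: algebra_simps)
  qed (use U W in \<open>rule subspace_inter\<close>)
  show "Poly_Mapping.lookup ((emb U \<circ> emb W) v) n = Poly_Mapping.lookup (emb (U \<inter> W) v) n"
    using U W
    by (simp add: lookup_emb subspace_inter PI proj_add[OF U] PP PQ)
qed

lemma emb_orth_comp: assumes "subspace U" shows "emb (orth U) \<circ> emb U = t_inv scale"
proof -
  have "orth U \<inter> U = {0}" using assms orth_disjoint by (auto simp: subspace_0)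
  then show ?thesis using emb_comp[of "orth U" U] assms by (simp add: emb_zero)
qed

text \<open>Composing with \<open>emb (orth U)\<close> on either side gives the bijection
  \<open>t^-1\<close>, so \<open>emb U\<close> is bijective. Its value at t = 1 is
  \<open>P_U + Q_U\<close>, the identity.\<close>

lemma emb_PPU: assumes U: "subspace U" shows "emb U \<in> carrier (PPU scale b)"
proof -
  have t: "bij (t_inv scale)" using t_inv_PPU by (simp add: PPU_def PU_def)
  have comp: "emb (orth U) \<circ> emb U = t_inv scale" "emb U \<circ> emb (orth U) = t_inv scale"
    using emb_orth_comp[OF U] emb_orth_comp[of "orth U"] U by simp_all
  have "inj (emb U)"
    by (rule inj_on_imageI2[of "emb (orth U)"]) (simp only: comp(1) bij_is_inj[OF t])
  moreover have "surj (emb U)"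
    using bij_is_surj[OF t] unfolding comp(2)[symmetric] by (auto simp: surj_def)
  ultimately have "bij (emb U)" by (simp add: bij_def)
  moreover have "eval_one (emb U) = id"
    by (rule ext) (simp add: eval_one_eq emb_monom[OF U] coeff_sum_add)
  ultimately show ?thesis
    using laurent_hom_emb[OF U] laurent_form_emb[OF U] by (simp add: PPU_def PU_def)
qed

lemma laurent_coeff_emb:
  assumes "subspace U"
  shows "laurent_coeff (emb U) i x = (proj U x when i = 0) + (x - proj U x when i = - 1)"
  by (auto simp: laurent_coeff_def lookup_emb[OF assms] lookup_single when_def assms)

lemma laurent_coeff_emb_comp:
  assumes "subspace U"
  shows "laurent_coeff (emb U \<circ> \<phi>) i x =
    proj U (laurent_coeff \<phi> i x) + (laurent_coeff \<phi> (i + 1) x - proj U (laurent_coeff \<phi> (i + 1) x))"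
  by (simp add: laurent_coeff_def lookup_emb[OF assms])

lemma laurent_coeff_t_inv_comp: "laurent_coeff (t_inv scale \<circ> \<phi>) i x = laurent_coeff \<phi> (i + 1) x"
  by (simp add: laurent_coeff_def lookup_t_inv)

lemma emb_PPU_neg: "subspace U \<Longrightarrow> emb U \<in> PPU_neg scale b"
  by (simp add: PPU_neg_def emb_PPU fun_eq_iff laurent_coeff_emb)

lemma emb_inject: assumes "subspace U" "subspace W" "emb U = emb W" shows "U = W"
proof -
  have "proj U x = proj W x" for x
    using laurent_coeff_emb[OF assms(1), of 0 x] laurent_coeff_emb[OF assms(2), of 0 x] assms(3) by simp
  then show ?thesis using assms(1,2) by (metis proj_id proj_mem(1) subsetI subset_antisym)
qed

lemma t_inv_central: "\<phi> \<in> carrier (PPU scale b) \<Longrightarrow> \<phi> \<circ> t_inv scale = t_inv scale \<circ> \<phi>"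
  using PPU_hom by (auto simp: laurent_hom_iff t_inv_def)

text \<open>Rewrites the inverse of \<open>emb U\<close> as t times \<open>emb (orth U)\<close>, and
  matches the complement on the interval with \<open>orth\<close>.\<close>

lemma t_inv_mult_inv_emb:
  assumes "subspace U"
  shows "t_inv scale \<circ> inv\<^bsub>PPU scale b\<^esub> (emb U) = emb (orth U)"
proof -
  interpret G: group "PPU scale b" by (rule group_PPU)
  have "emb U \<circ> inv\<^bsub>PPU scale b\<^esub> (emb U) = id" using G.r_inv[OF emb_PPU[OF assms]] by simp
  then have "emb (orth U) \<circ> emb U \<circ> inv\<^bsub>PPU scale b\<^esub> (emb U) = emb (orth U)"
    by (simp add: comp_assoc)
  then show ?thesis by (simp add: emb_orth_comp[OF assms])
qed

text \<open>The quotient of \<open>emb U\<close> by \<open>emb W\<close> is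
  \<open>t (P_U + t^-1 Q_U) (Q_W + t^-1 P_W)\<close>. Its only term of positive degree is
  \<open>t P_U Q_W\<close>, which vanishes exactly if
  \<open>orth W \<subseteq> orth U\<close>.\<close>

lemma emb_le_iff:
  assumes U: "subspace U" and W: "subspace W"
  shows "emb U \<sqsubseteq>\<^bsub>PPU_order scale b\<^esub> emb W \<longleftrightarrow> U \<subseteq> W"
proof -
  interpret G: group "PPU scale b" by (rule group_PPU)
  let ?i = "inv\<^bsub>PPU scale b\<^esub> (emb W)"
  have i: "?i \<in> carrier (PPU scale b)" by (simp add: emb_PPU W)
  have mem: "emb U \<circ> ?i \<in> carrier (PPU scale b)" using G.m_closed[OF emb_PPU[OF U] i] by simp
  have "t_inv scale \<circ> (emb U \<circ> ?i) = emb U \<circ> (t_inv scale \<circ> ?i)"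
    by (simp only: comp_assoc[symmetric] t_inv_central[OF emb_PPU[OF U]])
  then have "t_inv scale \<circ> (emb U \<circ> ?i) = emb U \<circ> emb (orth W)"
    by (simp add: t_inv_mult_inv_emb[OF W])
  then have "laurent_coeff (emb U \<circ> ?i) i x = laurent_coeff (emb U \<circ> emb (orth W)) (i - 1) x" for i x
    using laurent_coeff_t_inv_comp[of "emb U \<circ> ?i" "i - 1" x] by simp
  then have coeff: "laurent_coeff (emb U \<circ> ?i) i x = (proj U (x - proj W x) when i = 1)" if "i > 0" for i x
    using that U by (simp add: laurent_coeff_emb_comp laurent_coeff_emb proj_orth[OF W] when_def)
  have "emb U \<sqsubseteq>\<^bsub>PPU_order scale b\<^esub> emb W \<longleftrightarrow> emb U \<circ> ?i \<in> PPU_neg scale b"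
    by (simp add: PPU_order_def)
  also have "\<dots> \<longleftrightarrow> (\<forall>i>0. \<forall>x. laurent_coeff (emb U \<circ> ?i) i x = 0)"
    using mem by (auto simp: PPU_neg_def fun_eq_iff)
  also have "\<dots> \<longleftrightarrow> (\<forall>x. proj U (x - proj W x) = 0)"
    using coeff by (auto simp: when_def)
  also have "\<dots> \<longleftrightarrow> orth W \<subseteq> orth U"
  proof
    assume *: "\<forall>x. proj U (x - proj W x) = 0"
    show "orth W \<subseteq> orth U"
    proof
      fix x assume "x \<in> orth W"
      then have "proj U x = 0" using *[rule_format, of x] by (simp add: proj_orth_zero[OF W])
      then show "x \<in> orth U" using proj_mem(2)[OF U, of x] by simp
    qed
  next
    assume "orth W \<subseteq> orth U"
    then show "\<forall>x. proj U (x - proj W x) = 0" using proj_mem(2)[OF W] proj_orth_zero[OF U] by blast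
  qed
  also have "\<dots> \<longleftrightarrow> U \<subseteq> W" using orth_antimono[of "orth W" "orth U"] orth_antimono[of U W] U W by auto
  finally show ?thesis .
qed


section \<open>Factorization of paraunitary automorphisms\<close>

text \<open>The length bound \<open>m\<close> is the induction variable of both the injectivity and
  the surjectivity argument.\<close>

definition within :: "nat \<Rightarrow> ((int \<Rightarrow>\<^sub>0 'v) \<Rightarrow> (int \<Rightarrow>\<^sub>0 'v)) \<Rightarrow> bool"
  where "within m \<phi> \<longleftrightarrow> (\<forall>i x. laurent_coeff \<phi> i x \<noteq> 0 \<longrightarrow> - int m \<le> i \<and> i \<le> 0)"

lemma withinD: "within m \<phi> \<Longrightarrow> i < - int m \<or> i > 0 \<Longrightarrow> laurent_coeff \<phi> i x = 0"
  by (force simp: within_def)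

text \<open>An automorphism with only a coefficient of degree 0 agrees with its value at t = 1, and
  purity makes that the identity.\<close>

lemma within_zero_id:
  assumes \<phi>: "\<phi> \<in> carrier (PPU scale b)" and "within 0 \<phi>"
  shows "\<phi> = id"
proof (rule laurent_hom_eqI)
  show "laurent_hom \<phi>" using \<phi> by (rule PPU_hom)
  show "laurent_hom id" by (simp add: laurent_hom_iff)
  have coeff: "laurent_coeff \<phi> i x = (laurent_coeff \<phi> 0 x when i = 0)" for i x
    using withinD[OF assms(2), of i x] by (auto simp: when_def neq_iff)
  have "eval_one \<phi> x = laurent_coeff \<phi> 0 x" for x
    unfolding eval_one_def by (subst coeff) simp
  then show "laurent_coeff \<phi> i = laurent_coeff id i" for i
    using \<phi> coeff[of i] by (auto simp: PPU_def laurent_coeff_def[of id] lookup_single when_def)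
qed

lemma PPU_neg_within: assumes "\<phi> \<in> PPU_neg scale b" obtains m where "within m \<phi>"
proof -
  have "laurent_hom \<phi>" using assms by (intro PPU_hom[of \<phi> b]) (simp add: PPU_neg_def)
  then have fin: "finite {i. laurent_coeff \<phi> i \<noteq> (\<lambda>v. 0)}" (is "finite ?S")
    by (rule laurent_coeff_finite_support)
  \<comment> \<open>The inserted 0 keeps \<open>Max\<close> defined when no coefficient is nonzero,
    which happens for the zero space.\<close>
  define m where "m = nat (Max (insert 0 (uminus ` ?S)))"
  have "- int m \<le> i \<and> i \<le> 0" if "laurent_coeff \<phi> i x \<noteq> 0" for i x
  proof
    have i: "i \<in> ?S" using that by auto
    then have "- i \<le> Max (insert 0 (uminus ` ?S))" using fin by (intro Max_ge) auto
    then show "- int m \<le> i" by (simp add: m_def)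
    show "i \<le> 0" using that assms by (auto simp: PPU_neg_def simp flip: not_less)
  qed
  then have "within m \<phi>" by (auto simp: within_def)
  then show ?thesis by (rule that)
qed

text \<open>Isometry moves \<open>\<phi>\<close> to the other argument as its inverse; then
  coefficients of degree -n are compared on constant vectors, where a single summand survives on
  each side. Upper degree bounds for the inverse thus become lower bounds for
  \<open>\<phi>\<close>.\<close>

lemma laurent_coeff_adjoint:
  assumes \<phi>: "\<phi> \<in> carrier (PPU scale b)"
  shows "b (laurent_coeff \<phi> n x) y = b x (laurent_coeff (inv\<^bsub>PPU scale b\<^esub> \<phi>) (- n) y)"
proof -
  interpret G: group "PPU scale b" by (rule group_PPU)
  let ?\<psi> = "inv\<^bsub>PPU scale b\<^esub> \<phi>"
  have "\<phi> (?\<psi> v) = v" for v using fun_cong[OF G.r_inv[OF \<phi>]] by simp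
  then have "laurent_form b (\<phi> (monom 0 x)) (monom 0 y) = laurent_form b (\<phi> (monom 0 x)) (\<phi> (?\<psi> (monom 0 y)))"
    by simp
  also have "\<dots> = laurent_form b (monom 0 x) (?\<psi> (monom 0 y))"
    using \<phi> by (simp add: PPU_def PU_def)
  finally have eq: "laurent_form b (\<phi> (monom 0 x)) (monom 0 y) = laurent_form b (monom 0 x) (?\<psi> (monom 0 y))" .
  have "b (Poly_Mapping.lookup (\<phi> (monom 0 x)) (i + n)) (y when 0 = i) =
      (b (laurent_coeff \<phi> n x) y when i = 0)" for i
    by (simp add: when_def laurent_coeff_def)
  then have "Poly_Mapping.lookup (laurent_form b (\<phi> (monom 0 x)) (monom 0 y)) (- n) =
      b (laurent_coeff \<phi> n x) y"
    by (simp add: lookup_laurent_form lookup_single)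
  moreover have "b (x when 0 = i + n) (Poly_Mapping.lookup (?\<psi> (monom 0 y)) i) =
      (b x (laurent_coeff ?\<psi> (- n) y) when i = - n)" for i
    by (auto simp: when_def laurent_coeff_def)
  then have "Poly_Mapping.lookup (laurent_form b (monom 0 x) (?\<psi> (monom 0 y))) (- n) =
      b x (laurent_coeff ?\<psi> (- n) y)"
    by (simp add: lookup_laurent_form lookup_single)
  ultimately show ?thesis by (simp add: eq)
qed

text \<open>In degree \<open>m + 1\<close> the form of two constant vectors has coefficient 0. On
  the image side the degree bounds leave only the pairing of the lowest with the highest
  coefficient.\<close>

lemma within_extremal_orth:
  assumes \<phi>: "\<phi> \<in> carrier (PPU scale b)" and w: "within (Suc m) \<phi>"
  shows "b (laurent_coeff \<phi> (- int (Suc m)) x) (laurent_coeff \<phi> 0 y) = 0"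
proof -
  let ?n = "int (Suc m)"
  have "b (laurent_coeff \<phi> (i - ?n) x) (laurent_coeff \<phi> i y) =
      (b (laurent_coeff \<phi> (- ?n) x) (laurent_coeff \<phi> 0 y) when i = 0)" for i
    using withinD[OF w, of "i - ?n" x] withinD[OF w, of i y]
    by (cases i "0::int" rule: linorder_cases) auto
  then have "Poly_Mapping.lookup (laurent_form b (\<phi> (monom 0 x)) (\<phi> (monom 0 y))) ?n =
      b (laurent_coeff \<phi> (- ?n) x) (laurent_coeff \<phi> 0 y)"
    by (simp add: lookup_laurent_form laurent_coeff_def)
  moreover have "laurent_form b (\<phi> (monom 0 x)) (\<phi> (monom 0 y)) = laurent_form b (monom 0 x) (monom 0 y)"
    using \<phi> by (simp add: PPU_def PU_def)
  moreover have "b (x when 0 = i - ?n) (y when 0 = i) = 0" for i by (auto simp: when_def)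
  then have "Poly_Mapping.lookup (laurent_form b (monom 0 x) (monom 0 y)) ?n = 0"
    by (simp add: lookup_laurent_form lookup_single)
  ultimately show ?thesis by simp
qed

lemma subspace_range_laurent_coeff: "laurent_hom \<phi> \<Longrightarrow> subspace (range (laurent_coeff \<phi> i))"
  by (rule subspaceI)
    (auto simp flip: laurent_coeff_add laurent_coeff_scale intro: range_eqI laurent_coeff_zero[symmetric])

text \<open>Dividing by \<open>emb U\<close> gives coefficients
  \<open>Q_U \<phi>_(i-1) + P_U \<phi>_i\<close>. In degree 1 this vanishes because \<open>U\<close>
  is the image of \<open>\<phi>_0\<close>, and in degree \<open>- (m + 1)\<close> because the lowest
  coefficient takes values in \<open>orth U\<close>. So the length drops by one.\<close>

lemma within_factor:
  assumes \<phi>: "\<phi> \<in> carrier (PPU scale b)" and w: "within (Suc m) \<phi>"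
  obtains \<psi> where "\<psi> \<in> carrier (PPU scale b)" "within m \<psi>"
    "\<phi> = emb (range (laurent_coeff \<phi> 0)) \<circ> \<psi>"
proof -
  interpret G: group "PPU scale b" by (rule group_PPU)
  define U where "U = range (laurent_coeff \<phi> 0)"
  have U: "subspace U" unfolding U_def using \<phi> by (intro subspace_range_laurent_coeff PPU_hom)
  define \<psi> where "\<psi> = inv\<^bsub>PPU scale b\<^esub> (emb U) \<circ> \<phi>"
  have \<psi>: "\<psi> \<in> carrier (PPU scale b)"
    using G.m_closed[OF G.inv_closed[OF emb_PPU[OF U]] \<phi>] by (simp add: \<psi>_def)
  have "emb U \<circ> inv\<^bsub>PPU scale b\<^esub> (emb U) = id" using G.r_inv[OF emb_PPU[OF U]] by simp
  then have "\<phi> = emb U \<circ> \<psi>" by (simp add: \<psi>_def flip: comp_assoc)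
  moreover have "t_inv scale \<circ> \<psi> = emb (orth U) \<circ> \<phi>"
    by (simp add: \<psi>_def t_inv_mult_inv_emb[OF U, symmetric] comp_assoc)
  then have coeff: "laurent_coeff \<psi> i x = (laurent_coeff \<phi> (i - 1) x - proj U (laurent_coeff \<phi> (i - 1) x)) +
      proj U (laurent_coeff \<phi> i x)" for i x
    using laurent_coeff_t_inv_comp[of \<psi> "i - 1" x]
    by (simp add: laurent_coeff_emb_comp proj_orth[OF U])
  have "within m \<psi>"
    unfolding within_def
  proof (intro allI impI)
    fix i x assume nz: "laurent_coeff \<psi> i x \<noteq> 0"
    have "i \<noteq> 1"
    proof
      assume "i = 1"
      then have "laurent_coeff \<phi> (i - 1) x \<in> U" "laurent_coeff \<phi> i x = 0"
        using withinD[OF w, of i x] by (auto simp: U_def)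
      then show False using nz U by (simp add: coeff proj_id)
    qed
    moreover have "i \<noteq> - int (Suc m)"
    proof
      assume i: "i = - int (Suc m)"
      then have "laurent_coeff \<phi> i x \<in> orth U" "laurent_coeff \<phi> (i - 1) x = 0"
        using withinD[OF w, of "i - 1" x] within_extremal_orth[OF \<phi> w, of x] symmetric
        by (auto simp: U_def orth_def)
      then show False using nz U by (simp add: coeff proj_orth_zero)
    qed
    moreover have "- int (Suc m) \<le> i \<and> i \<le> 1"
    proof (rule ccontr)
      assume "\<not> ?thesis"
      then show False
        using nz withinD[OF w, of i x] withinD[OF w, of "i - 1" x] U by (auto simp: coeff)
    qed
    ultimately show "- int m \<le> i \<and> i \<le> 0" by linarith
  qed
  ultimately show ?thesis using that[OF \<psi>] unfolding U_def by blast
qed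

section \<open>The interval as the image of the lattice of subspaces\<close>

text \<open>The bound \<open>g \<le> 1\<close> excludes positive degrees of \<open>g\<close>. The
  bound \<open>t^-1 \<le> g\<close> restricts its inverse to degrees at most 1, so by the adjoint
  formula \<open>g\<close> has no degree below -1. Splitting off one factor leaves length 0, that
  is, the identity.\<close>

lemma PPU_interval_carrier: "carrier (PPU_interval scale b) = emb ` {U. subspace U}"
proof (rule subset_antisym)
  interpret G: group "PPU scale b" by (rule group_PPU)
  have carr: "g \<in> carrier (PPU_interval scale b) \<longleftrightarrow> g \<in> carrier (PPU scale b) \<and>
      t_inv scale \<circ> inv\<^bsub>PPU scale b\<^esub> g \<in> PPU_neg scale b \<and> g \<in> PPU_neg scale b" for g
    using G.inv_one by (simp add: PPU_interval_def at_least_at_most_def PPU_order_def)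
  show "emb ` {U. subspace U} \<subseteq> carrier (PPU_interval scale b)"
    by (auto simp: carr emb_PPU emb_PPU_neg t_inv_mult_inv_emb)
  show "carrier (PPU_interval scale b) \<subseteq> emb ` {U. subspace U}"
  proof
    fix g assume "g \<in> carrier (PPU_interval scale b)"
    then have g: "g \<in> carrier (PPU scale b)" "t_inv scale \<circ> inv\<^bsub>PPU scale b\<^esub> g \<in> PPU_neg scale b"
      "g \<in> PPU_neg scale b"
      by (simp_all add: carr)
    have "laurent_coeff g i x = 0" if "i < - 1" for i x
    proof -
      have "laurent_coeff (inv\<^bsub>PPU scale b\<^esub> g) (- i) y = 0" for y
        using g(2) that laurent_coeff_t_inv_comp[of "inv\<^bsub>PPU scale b\<^esub> g" "- i - 1" y]
        by (simp add: PPU_neg_def)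
      then have "b (laurent_coeff g i x) (laurent_coeff g i x) = 0"
        by (simp add: laurent_coeff_adjoint[OF g(1)])
      then show ?thesis by (simp add: anisotropic)
    qed
    then have "within (Suc 0) g"
      using g(3) unfolding within_def PPU_neg_def by (auto simp flip: not_less)
    then obtain \<psi> where \<psi>: "\<psi> \<in> carrier (PPU scale b)" "within 0 \<psi>" "g = emb (range (laurent_coeff g 0)) \<circ> \<psi>"
      using within_factor[OF g(1)] by blast
    then have "g = emb (range (laurent_coeff g 0))" using within_zero_id[of \<psi>] by simp
    then show "g \<in> emb ` {U. subspace U}"
      using subspace_range_laurent_coeff[OF PPU_hom[OF g(1)]] by blast
  qed
qed


section \<open>The structure group of the lattice of subspaces\<close>

sublocale L: orthomodular_lattice subspaces
  by (rule orthomodular_lattice_subspaces)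

sublocale S: group "structure_group subspaces"
  by (rule group_structure_group)

sublocale P: group "PPU scale b"
  by (rule group_PPU)

text \<open>The side condition of a structure relation is precisely the hypothesis of
  \<open>emb_comp\<close>, so \<open>emb\<close> extends to the presented group.\<close>

lemma structure_group_hom_PPU:
  obtains \<Phi> where "\<Phi> \<in> hom (structure_group subspaces) (PPU scale b)"
    "\<And>U. subspace U \<Longrightarrow> \<Phi> (structure_gen subspaces U) = emb U"
proof -
  have emb: "emb \<in> carrier subspaces \<rightarrow> carrier (PPU scale b)" by (simp add: emb_PPU)
  have rel: "eval_word (PPU scale b) emb u = eval_word (PPU scale b) emb v"
    if "(u, v) \<in> structure_relations subspaces" for u v
    using that by (auto simp: structure_relations_def emb_comp subspace_lattice_meet)
  obtain \<Phi> where \<Phi>: "\<Phi> \<in> hom (presented_group (carrier subspaces) (structure_relations subspaces)) (PPU scale b)"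
    "\<And>u. u \<in> words (carrier subspaces) \<Longrightarrow>
      \<Phi> (pres_class (carrier subspaces) (structure_relations subspaces) u) = eval_word (PPU scale b) emb u"
    using P.presented_group_hom_ext[OF emb rel] by blast
  show ?thesis
  proof (rule that)
    show "\<Phi> \<in> hom (structure_group subspaces) (PPU scale b)"
      using \<Phi>(1) by (simp add: structure_group_def)
    show "\<Phi> (structure_gen subspaces U) = emb U" if "subspace U" for U
      using \<Phi>(2)[of "[(U, True)]"] that by (simp add: structure_gen_def)
  qed
qed

section \<open>Injectivity of the homomorphism into the paraunitary group\<close>

context
  fixes \<Phi>
  assumes hom: "\<Phi> \<in> hom (structure_group subspaces) (PPU scale b)"
    and gen: "\<And>U. subspace U \<Longrightarrow> \<Phi> (structure_gen subspaces U) = emb U"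
begin

lemma structure_hom_one: "\<Phi> \<one>\<^bsub>structure_group subspaces\<^esub> = id"
  using hom_one[OF hom S.is_group P.is_group] by simp

lemma structure_hom_mult_gen:
  assumes "subspace U" "g \<in> carrier (structure_group subspaces)"
  shows "\<Phi> (structure_gen subspaces U \<otimes>\<^bsub>structure_group subspaces\<^esub> g) = emb U \<circ> \<Phi> g"
  using hom_mult[OF hom, of "structure_gen subspaces U" g] assms gen by simp

lemma structure_hom_monoid: "p \<in> L.structure_monoid \<Longrightarrow> \<Phi> p \<in> PPU_neg scale b"
proof (induction rule: L.structure_monoid.induct)
  case (gen U p)
  then have U: "subspace U" and p: "p \<in> carrier (structure_group subspaces)"
    by (simp_all add: L.structure_monoid_closed)
  show ?case
    unfolding structure_hom_mult_gen[OF U p] using emb_PPU_neg[OF U] gen.IH by (rule PPU_neg_comp)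
qed (simp only: structure_hom_one PPU_neg_one)

lemma structure_hom_monoid_PPU: "p \<in> L.structure_monoid \<Longrightarrow> \<Phi> p \<in> carrier (PPU scale b)"
  using structure_hom_monoid by (simp add: PPU_neg_def)

text \<open>
  The factor split off here is determined by \<open>\<Phi> p\<close> alone, which makes \<open>p\<close> recoverable from \<open>\<Phi> p\<close>.
\<close>

lemma structure_monoid_factor:
  assumes "p \<in> L.structure_monoid"
  shows "\<exists>q\<in>L.structure_monoid. p =
    structure_gen subspaces (range (laurent_coeff (\<Phi> p) 0)) \<otimes>\<^bsub>structure_group subspaces\<^esub> q"
  using assms
proof (induction rule: L.structure_monoid.induct)
  case one
  \<comment> \<open>The identity has degree-0 image \<top>, and the generator \<top> is the neutral
    element.\<close>
  have "range (laurent_coeff id 0 :: 'v \<Rightarrow> 'v) = UNIV"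
    by (auto simp: laurent_coeff_def lookup_single)
  then have "structure_gen subspaces (range (laurent_coeff (\<Phi> \<one>\<^bsub>structure_group subspaces\<^esub>) 0)) =
      \<one>\<^bsub>structure_group subspaces\<^esub>"
    using L.structure_gen_top unfolding structure_hom_one top_subspaces by (simp only:)
  then show ?case using L.structure_monoid.one S.l_one[OF S.one_closed] by metis
next
  case (gen U p)
  define W where "W = range (laurent_coeff (\<Phi> p) 0)"
  obtain q where q: "q \<in> L.structure_monoid" "p = structure_gen subspaces W \<otimes>\<^bsub>structure_group subspaces\<^esub> q"
    using gen.IH unfolding W_def by blast
  have U: "subspace U" and p: "p \<in> carrier (structure_group subspaces)"
    using gen by (simp_all add: L.structure_monoid_closed)
  have W: "subspace W"
    unfolding W_def using gen by (intro subspace_range_laurent_coeff PPU_hom[of _ b] structure_hom_monoid_PPU)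
  \<comment> \<open>With no coefficient in degree 1, the degree-0 coefficient of the product is just
    \<open>P_U\<close> after that of \<open>\<Phi> p\<close>. Its image is the projection of
    \<open>W\<close> to \<open>U\<close>, which is the left factor in the Sasaki identity.\<close>
  have "laurent_coeff (\<Phi> p) 1 x = 0" for x
    using structure_hom_monoid[OF gen.hyps(2)] by (simp add: PPU_neg_def)
  then have "laurent_coeff (emb U \<circ> \<Phi> p) 0 = proj U \<circ> laurent_coeff (\<Phi> p) 0"
    by (simp add: fun_eq_iff laurent_coeff_emb_comp U)
  then have range: "range (laurent_coeff (emb U \<circ> \<Phi> p) 0) =
      U \<sqinter>\<^bsub>subspaces\<^esub> (\<midarrow>\<^bsub>subspaces\<^esub> U \<squnion>\<^bsub>subspaces\<^esub> W)"
    using proj_image[OF U W] by (simp add: W_def image_comp)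
  obtain w where w: "w \<in> carrier subspaces"
    "structure_gen subspaces U \<otimes>\<^bsub>structure_group subspaces\<^esub> structure_gen subspaces W =
     structure_gen subspaces (U \<sqinter>\<^bsub>subspaces\<^esub> (\<midarrow>\<^bsub>subspaces\<^esub> U \<squnion>\<^bsub>subspaces\<^esub> W))
       \<otimes>\<^bsub>structure_group subspaces\<^esub> structure_gen subspaces w"
    using L.structure_gen_mult_sasaki[of U W] U W by auto
  have closed: "structure_gen subspaces U \<in> carrier (structure_group subspaces)"
    "structure_gen subspaces W \<in> carrier (structure_group subspaces)"
    "structure_gen subspaces w \<in> carrier (structure_group subspaces)"
    "structure_gen subspaces (U \<sqinter>\<^bsub>subspaces\<^esub> (\<midarrow>\<^bsub>subspaces\<^esub> U \<squnion>\<^bsub>subspaces\<^esub> W))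
      \<in> carrier (structure_group subspaces)"
    using U W w(1) by (auto simp: subspace_lattice_join subspace_lattice_meet subspace_sums subspace_inter)
  have "structure_gen subspaces U \<otimes>\<^bsub>structure_group subspaces\<^esub> p =
      structure_gen subspaces (U \<sqinter>\<^bsub>subspaces\<^esub> (\<midarrow>\<^bsub>subspaces\<^esub> U \<squnion>\<^bsub>subspaces\<^esub> W))
       \<otimes>\<^bsub>structure_group subspaces\<^esub> (structure_gen subspaces w \<otimes>\<^bsub>structure_group subspaces\<^esub> q)"
    using closed L.structure_monoid_closed[OF q(1)] w(2) q(2) by (metis S.m_assoc)
  then show ?case
    using L.structure_monoid.gen[OF w(1) q(1)] unfolding structure_hom_mult_gen[OF U p] range by blast
qed

text \<open>The negative cone has no units besides the identity, so each factor \<open>emb U\<close>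
  of a product equal to the identity is trivial, and then \<open>U\<close> is \<top>.\<close>

lemma structure_monoid_eq_one:
  assumes "p \<in> L.structure_monoid" "\<Phi> p = id"
  shows "p = \<one>\<^bsub>structure_group subspaces\<^esub>"
  using assms
proof (induction rule: L.structure_monoid.induct)
  case (gen U p)
  have U: "subspace U" using gen by simp
  have "emb U \<circ> \<Phi> p = id"
    using gen.prems unfolding structure_hom_mult_gen[OF U L.structure_monoid_closed[OF gen.hyps(2)]] .
  moreover from this have id: "emb U = id"
    by (rule PPU_neg_inverse[OF emb_PPU_neg[OF U] structure_hom_monoid[OF gen.hyps(2)]])
  ultimately have "p = \<one>\<^bsub>structure_group subspaces\<^esub>" using gen.IH by simp
  moreover have "U = \<top>\<^bsub>subspaces\<^esub>"
    using emb_inject[OF U subspace_UNIV] id by (simp add: emb_UNIV top_subspaces)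
  ultimately show ?case by (simp add: L.structure_gen_top)
qed simp

text \<open>The first generator split off is read from the common image, so it is the same for
  \<open>p\<close> and \<open>q\<close>. Cancelling it leaves products of generators whose common
  image is shorter.\<close>

lemma structure_hom_inj_monoid:
  assumes "p \<in> L.structure_monoid" "q \<in> L.structure_monoid" "\<Phi> p = \<Phi> q" "within m (\<Phi> p)"
  shows "p = q"
  using assms
proof (induction m arbitrary: p q)
  case 0
  then have "\<Phi> p = id" by (intro within_zero_id structure_hom_monoid_PPU)
  then show ?case using 0 structure_monoid_eq_one by metis
next
  case (Suc m)
  define U where "U = range (laurent_coeff (\<Phi> p) 0)"
  have U: "subspace U"
    unfolding U_def using Suc.prems by (intro subspace_range_laurent_coeff PPU_hom[of _ b] structure_hom_monoid_PPU)
  obtain \<psi> where \<psi>: "\<psi> \<in> carrier (PPU scale b)" "within m \<psi>" "\<Phi> p = emb U \<circ> \<psi>"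
    using within_factor[OF structure_hom_monoid_PPU[OF Suc.prems(1)] Suc.prems(4)] unfolding U_def by blast
  have factor: "\<exists>r\<in>L.structure_monoid. g = structure_gen subspaces U \<otimes>\<^bsub>structure_group subspaces\<^esub> r \<and> \<Phi> r = \<psi>"
    if g: "g \<in> L.structure_monoid" "\<Phi> g = \<Phi> p" for g
  proof -
    obtain r where r: "r \<in> L.structure_monoid" "g = structure_gen subspaces U \<otimes>\<^bsub>structure_group subspaces\<^esub> r"
      using structure_monoid_factor[OF g(1)] g(2) unfolding U_def by auto
    then have "emb U \<circ> \<Phi> r = emb U \<circ> \<psi>"
      using \<psi>(3) g(2) structure_hom_mult_gen[OF U L.structure_monoid_closed[OF r(1)]] by simp
    then have "\<Phi> r = \<psi>"
      using P.Units_l_cancel[of "emb U" "\<Phi> r" \<psi>] structure_hom_monoid_PPU[OF r(1)] \<psi>(1) emb_PPU[OF U]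
      by simp
    then show ?thesis using r by blast
  qed
  obtain p' where p': "p' \<in> L.structure_monoid"
    "p = structure_gen subspaces U \<otimes>\<^bsub>structure_group subspaces\<^esub> p'" "\<Phi> p' = \<psi>"
    using factor[OF Suc.prems(1)] by blast
  obtain q' where q': "q' \<in> L.structure_monoid"
    "q = structure_gen subspaces U \<otimes>\<^bsub>structure_group subspaces\<^esub> q'" "\<Phi> q' = \<psi>"
    using factor[OF Suc.prems(2)] Suc.prems(3) by metis
  have "p' = q'" using Suc.IH[OF p'(1) q'(1)] p'(3) q'(3) \<psi>(2) by simp
  then show ?case using p'(2) q'(2) by simp
qed

text \<open>For \<open>g\<close> in the kernel, a power of the generator \<bottom> and its product
  with \<open>g\<close> both lie in the monoid and have the same image, so injectivity on the monoid
  applies.\<close>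

lemma structure_hom_inj: "inj_on \<Phi> (carrier (structure_group subspaces))"
  unfolding inj_on_one_iff'[OF hom S.is_group P.is_group]
proof (intro allI impI)
  fix g assume g: "g \<in> carrier (structure_group subspaces)" and "\<Phi> g = \<one>\<^bsub>PPU scale b\<^esub>"
  let ?z = "structure_gen subspaces \<bottom>\<^bsub>subspaces\<^esub>"
  obtain n :: nat where n: "?z [^]\<^bsub>structure_group subspaces\<^esub> n \<otimes>\<^bsub>structure_group subspaces\<^esub> g \<in> L.structure_monoid"
    using L.structure_group_fractions[OF g] by blast
  let ?zn = "?z [^]\<^bsub>structure_group subspaces\<^esub> n"
  have zn: "?zn \<in> L.structure_monoid" by (rule L.bottom_pow_structure_monoid)
  have eq: "\<Phi> ?zn = \<Phi> (?zn \<otimes>\<^bsub>structure_group subspaces\<^esub> g)"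
    using hom_mult[OF hom L.structure_monoid_closed[OF zn] g] \<open>\<Phi> g = \<one>\<^bsub>PPU scale b\<^esub>\<close> by simp
  obtain m where "within m (\<Phi> ?zn)" using PPU_neg_within[OF structure_hom_monoid[OF zn]] .
  then have "?zn = ?zn \<otimes>\<^bsub>structure_group subspaces\<^esub> g"
    by (rule structure_hom_inj_monoid[OF zn n eq])
  then show "g = \<one>\<^bsub>structure_group subspaces\<^esub>"
    using S.l_cancel_one'[OF L.structure_monoid_closed[OF zn] g] by simp
qed

section \<open>Surjectivity onto the pure paraunitary group\<close>

lemma within_structure_hom_image:
  assumes "\<phi> \<in> carrier (PPU scale b)" "within m \<phi>"
  shows "\<phi> \<in> \<Phi> ` carrier (structure_group subspaces)"
  using assms
proof (induction m arbitrary: \<phi>)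
  case 0
  then have "\<phi> = \<Phi> \<one>\<^bsub>structure_group subspaces\<^esub>" using within_zero_id structure_hom_one by simp
  then show ?case by (rule image_eqI) simp
next
  case (Suc m)
  let ?U = "range (laurent_coeff \<phi> 0)"
  have U: "subspace ?U" using Suc.prems by (intro subspace_range_laurent_coeff PPU_hom)
  obtain \<psi> where \<psi>: "\<psi> \<in> carrier (PPU scale b)" "within m \<psi>" "\<phi> = emb ?U \<circ> \<psi>"
    using within_factor[OF Suc.prems] .
  then obtain g where g: "g \<in> carrier (structure_group subspaces)" "\<psi> = \<Phi> g"
    using Suc.IH by blast
  then have "\<phi> = \<Phi> (structure_gen subspaces ?U \<otimes>\<^bsub>structure_group subspaces\<^esub> g)"
    using \<psi>(3) structure_hom_mult_gen[OF U g(1)] by simp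
  then show ?case by (rule image_eqI) (use g(1) U in simp)
qed

text \<open>Multiplying by \<open>t^-1\<close> often enough removes all positive degrees, and the
  factorization then applies. This can be undone because \<open>t^-1\<close> is the image of the
  generator \<open>{0}\<close>.\<close>

lemma structure_hom_surj: "\<Phi> ` carrier (structure_group subspaces) = carrier (PPU scale b)"
proof (rule subset_antisym)
  show "\<Phi> ` carrier (structure_group subspaces) \<subseteq> carrier (PPU scale b)"
    using hom_in_carrier[OF hom] by blast
  interpret h: group_hom "structure_group subspaces" "PPU scale b" \<Phi>
    by unfold_locales (rule hom)
  have sub: "subgroup (\<Phi> ` carrier (structure_group subspaces)) (PPU scale b)"
    by (rule h.img_is_subgroup)
  have t: "t_inv scale \<in> \<Phi> ` carrier (structure_group subspaces)"
  proof (rule image_eqI)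
    show "t_inv scale = \<Phi> (structure_gen subspaces {0})" using gen[of "{0}"] by (simp add: emb_zero)
  qed simp
  have bounded: "\<phi> \<in> \<Phi> ` carrier (structure_group subspaces)"
    if "\<phi> \<in> carrier (PPU scale b)" "\<forall>i>int n. laurent_coeff \<phi> i = (\<lambda>v. 0)" for n \<phi>
    using that
  proof (induction n arbitrary: \<phi>)
    case 0
    then have "\<phi> \<in> PPU_neg scale b" by (simp add: PPU_neg_def)
    then show ?case using PPU_neg_within within_structure_hom_image 0(1) by metis
  next
    case (Suc n)
    have "laurent_coeff (t_inv scale \<circ> \<phi>) i = (\<lambda>v. 0)" if "i > int n" for i
      using Suc.prems(2) that by (auto simp: fun_eq_iff laurent_coeff_t_inv_comp)
    moreover have "t_inv scale \<circ> \<phi> \<in> carrier (PPU scale b)"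
      using P.m_closed[OF t_inv_PPU Suc.prems(1)] by (simp only: PU_simps)
    ultimately have "t_inv scale \<circ> \<phi> \<in> \<Phi> ` carrier (structure_group subspaces)"
      using Suc.IH by blast
    then have "inv\<^bsub>PPU scale b\<^esub> (t_inv scale) \<otimes>\<^bsub>PPU scale b\<^esub> (t_inv scale \<otimes>\<^bsub>PPU scale b\<^esub> \<phi>)
        \<in> \<Phi> ` carrier (structure_group subspaces)"
      using subgroup.m_closed[OF sub subgroup.m_inv_closed[OF sub t]] by simp
    moreover have "inv\<^bsub>PPU scale b\<^esub> (t_inv scale) \<otimes>\<^bsub>PPU scale b\<^esub> (t_inv scale \<otimes>\<^bsub>PPU scale b\<^esub> \<phi>) = \<phi>"
      using Suc.prems(1) t_inv_PPU by (metis P.inv_closed P.l_inv P.l_one P.m_assoc)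
    ultimately show ?case by simp
  qed
  show "carrier (PPU scale b) \<subseteq> \<Phi> ` carrier (structure_group subspaces)"
  proof
    fix \<phi> assume \<phi>: "\<phi> \<in> carrier (PPU scale b)"
    have "finite {i. laurent_coeff \<phi> i \<noteq> (\<lambda>v. 0)}"
      using \<phi> by (intro laurent_coeff_finite_support PPU_hom)
    then obtain n where n: "\<forall>i\<in>{i. laurent_coeff \<phi> i \<noteq> (\<lambda>v. 0)}. i \<le> n"
      using bdd_above_finite unfolding bdd_above_def by blast
    \<comment> \<open>The integer bound \<open>n\<close> may be negative; truncating it to 0 only
      weakens the bound.\<close>
    have "laurent_coeff \<phi> i = (\<lambda>v. 0)" if "i > int (nat n)" for i
    proof (rule ccontr)
      assume "laurent_coeff \<phi> i \<noteq> (\<lambda>v. 0)"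
      then have "i \<le> n" using n by simp
      then show False using that by (simp split: if_splits)
    qed
    then show "\<phi> \<in> \<Phi> ` carrier (structure_group subspaces)" using bounded[OF \<phi>] by blast
  qed
qed

end

text \<open>Order and complement are already matched by \<open>emb_le_iff\<close> and
  \<open>t_inv_mult_inv_emb\<close>, so the lattice structure is transported along
  \<open>emb\<close>.\<close>

lemma PPU_interval_oml:
  "orthomodular_lattice (PPU_interval scale b)" "emb \<in> oml_iso subspaces (PPU_interval scale b)"
proof -
  have bij: "bij_betw emb (carrier subspaces) (carrier (PPU_interval scale b))"
    using emb_inject by (simp add: bij_betw_def PPU_interval_carrier inj_on_def)
  have le: "emb U \<sqsubseteq>\<^bsub>PPU_interval scale b\<^esub> emb W \<longleftrightarrow> U \<sqsubseteq>\<^bsub>subspaces\<^esub> W"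
    if "U \<in> carrier subspaces" "W \<in> carrier subspaces" for U W
    using emb_le_iff[of U W] that by (simp add: PPU_interval_def)
  have ocomp: "\<midarrow>\<^bsub>PPU_interval scale b\<^esub> emb U = emb (\<midarrow>\<^bsub>subspaces\<^esub> U)"
    if "U \<in> carrier subspaces" for U
    using t_inv_mult_inv_emb[of U] that by (simp add: PPU_interval_def)
  have eq: "(.=\<^bsub>PPU_interval scale b\<^esub>) = (=)" by (simp add: PPU_interval_def)
  show "orthomodular_lattice (PPU_interval scale b)" "emb \<in> oml_iso subspaces (PPU_interval scale b)"
    by (rule L.order_iso_transport[OF bij eq]; rule le ocomp; assumption)+
qed

end

theorem theorem5:
  fixes scale :: "'k::field \<Rightarrow> 'v::ab_group_add \<Rightarrow> 'v"
    and Basis :: "'v set"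
    and b :: "'v \<Rightarrow> 'v \<Rightarrow> 'k"
  assumes "anisotropic_form scale Basis b"
  shows "orthomodular_lattice (subspace_lattice scale b) \<and>
    orthomodular_lattice (PPU_interval scale b) \<and>
    (\<exists>\<iota> \<in> oml_iso (subspace_lattice scale b) (PPU_interval scale b).
      \<exists>\<Phi> \<in> iso (structure_group (subspace_lattice scale b)) (PPU scale b).
        \<forall>U \<in> carrier (subspace_lattice scale b).
          \<Phi> (structure_gen (subspace_lattice scale b) U) = \<iota> U)"
proof -
  interpret anisotropic_form scale Basis b by (rule assms)
  obtain \<Phi> where \<Phi>: "\<Phi> \<in> hom (structure_group subspaces) (PPU scale b)"
    "\<And>U. subspace U \<Longrightarrow> \<Phi> (structure_gen subspaces U) = emb U"
    by (rule structure_group_hom_PPU) blast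
  have "\<Phi> \<in> iso (structure_group subspaces) (PPU scale b)"
    using \<Phi>(1) structure_hom_inj[OF \<Phi>] structure_hom_surj[OF \<Phi>] by (simp add: iso_def bij_betw_def)
  then show ?thesis
    using orthomodular_lattice_subspaces PPU_interval_oml \<Phi>(2)
    by (intro conjI bexI[of _ emb] bexI[of _ \<Phi>]) auto
qed

end
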